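(* Let $\rho(s)=\arcsin(s)$ and $r=\sqrt{1-s^2}$ for $0<s<1$, and let $\chi_I$ denote the indicator function of an interval $I\subset\mathbb{R}$. Let $\psi_0(\theta)=\cos\theta$, $\varphi_s(\theta)=\arccos(s\cos\theta)$ and $\psi_s(\theta)=\frac{1}{\arcsin(s)}\arcsin(s\cos\theta)$, and let $d\mu_t(k)$ be the probability measure on $\mathbb{R}$ associated with a continuous real-valued function $k$ on $S^1$ (defined in the context). Then the following weak limits of probability measures on $\mathbb{R}$ hold: (1) $\displaystyle \lim_{t\to\infty}d\mu_t(\psi_0)=\frac{1}{\pi\sqrt{1-x^2}}\chi_{(-1,1)}(x)\,dx$ weakly; (2) for every $0<s<1$, $\displaystyle \lim_{t\to\infty}d\mu_t(\varphi_s)=\frac{r}{\pi(1-x^2)\sqrt{s^2-x^2}}\chi_{(-s,s)}(x)\,dx$ weakly; (3) for every $0<s<1$, $\displaystyle \lim_{t\to\infty}d\mu_t(\psi_s)=\frac{\rho(s)\,r}{\pi(1-\rho(s)^2x^2)\sqrt{s^2-\rho(s)^2x^2}}\chi_{(-s/\rho(s),\,s/\rho(s))}(x)\,dx$ weakly.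
   Context: $\arccos$ and $\arcsin$ denote principal values (in $[0,\pi]$ and $[-\pi/2,\pi/2]$). Functions on the unit circle $S^1$ are identified with $2\pi$-periodic functions of $\theta\in\mathbb{R}$; $L^2(S^1)$ is taken with respect to the uniform probability measure $d\theta/2\pi$. The Fourier transform $\mathcal{F}:L^2(S^1)\to\ell^2(\mathbb{Z})$ is the unitary operator $\mathcal{F}(k)(x)=\frac{1}{2\pi}\int_0^{2\pi}e^{-ix\theta}k(\theta)\,d\theta$. For a continuous real-valued function $k$ on $S^1$, $M(k)$ is the operator of multiplication by $k$ on $L^2(S^1)$, and $\widehat{H}(k)=\mathcal{F}M(k)\mathcal{F}^*$, a bounded self-adjoint operator on $\ell^2(\mathbb{Z})$. For $t\in\mathbb{R}$ and $x\in\mathbb{Z}$ set $$p_t(k;x)=|\langle e^{it\widehat{H}(k)}\delta_0,\delta_x\rangle|^2,$$ where $\langle\cdot,\cdot\rangle$ is the standard inner product on $\ell^2(\mathbb{Z})$ and $\delta_x\in\ell^2(\mathbb{Z})$ is the function equal to $1$ at $x$ and $0$ elsewhere; $\{p_t(k;x)\}_{x\in\mathbb{Z}}$ is a probability distribution. For $t\neq 0$ define the probability measure on $\mathbb{R}$ $$d\mu_t(k)=\sum_{x\in\mathbb{Z}}p_t(k;x)\,\delta_{x/t},$$ where $\delta_\xi$ for $\xi\in\mathbb{R}$ here denotes the Dirac measure at $\xi$. *)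

theory Defs
  imports "HOL-Probability.Probability"
begin

definition ell2 :: "(int \<Rightarrow> complex) set" where
  "ell2 = {a. (\<lambda>x. (cmod (a x))\<^sup>2) summable_on UNIV}"

definition ell2_inner :: "(int \<Rightarrow> complex) \<Rightarrow> (int \<Rightarrow> complex) \<Rightarrow> complex" where
  "ell2_inner a b = (\<Sum>\<^sub>\<infinity>x. a x * cnj (b x))"

definition ell2_norm :: "(int \<Rightarrow> complex) \<Rightarrow> real" where
  "ell2_norm a = sqrt (\<Sum>\<^sub>\<infinity>x. (cmod (a x))\<^sup>2)"

definition ket :: "int \<Rightarrow> int \<Rightarrow> complex" where
  "ket x = (\<lambda>y. if y = x then 1 else 0)"

text \<open>
  The measure \<open>d\<theta>/2\<pi>\<close>. Functions on the circle are \<open>2\<pi>\<close>-periodic functions on the real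
  line; elements of \<open>L\<^sup>2(S\<^sup>1)\<close> are represented by actual functions, so that equality in
  \<open>L\<^sup>2(S\<^sup>1)\<close> is equality almost everywhere.
\<close>

definition circle_measure :: "real measure" where
  "circle_measure = uniform_measure lborel {0..2 * pi}"

definition L2_circle :: "(real \<Rightarrow> complex) set" where
  "L2_circle = {f. f \<in> borel_measurable borel \<and> (\<forall>\<theta>. f (\<theta> + 2 * pi) = f \<theta>) \<and>
                   integrable circle_measure (\<lambda>\<theta>. (cmod (f \<theta>))\<^sup>2)}"

definition L2_inner :: "(real \<Rightarrow> complex) \<Rightarrow> (real \<Rightarrow> complex) \<Rightarrow> complex" where
  "L2_inner f g = (LINT \<theta>|circle_measure. f \<theta> * cnj (g \<theta>))"

definition fourier :: "(real \<Rightarrow> complex) \<Rightarrow> int \<Rightarrow> complex" where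
  "fourier f x = 1 / (2 * pi) * (LINT \<theta>:{0..2 * pi}|lborel. exp (- \<i> * of_int x * of_real \<theta>) * f \<theta>)"

text \<open>
  The adjoint of \<open>fourier\<close>. The representative is determined only up to a null set, which is
  invisible to \<open>fourier\<close> and \<open>L2_inner\<close>.
\<close>

definition fourier_adj :: "(int \<Rightarrow> complex) \<Rightarrow> real \<Rightarrow> complex" where
  "fourier_adj a = (SOME f. f \<in> L2_circle \<and>
     (\<forall>g\<in>L2_circle. ell2_inner (fourier g) a = L2_inner g f))"

definition mult_op :: "(real \<Rightarrow> real) \<Rightarrow> (real \<Rightarrow> complex) \<Rightarrow> real \<Rightarrow> complex" where
  "mult_op k f = (\<lambda>\<theta>. of_real (k \<theta>) * f \<theta>)"

definition H_hat :: "(real \<Rightarrow> real) \<Rightarrow> (int \<Rightarrow> complex) \<Rightarrow> int \<Rightarrow> complex" where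
  "H_hat k = (\<lambda>a. fourier (mult_op k (fourier_adj a)))"

text \<open>
  The exponential series \<open>\<Sum>n. A\<^sup>n a / n!\<close> of an operator on \<open>\<ell>\<^sup>2(\<int>)\<close>, applied to a vector, with
  convergence in the norm of \<open>\<ell>\<^sup>2(\<int>)\<close>. For a bounded operator \<open>A\<close> the series also converges in
  operator norm, with the same sum.
\<close>

definition op_exp :: "((int \<Rightarrow> complex) \<Rightarrow> int \<Rightarrow> complex) \<Rightarrow> (int \<Rightarrow> complex) \<Rightarrow> int \<Rightarrow> complex" where
  "op_exp A a = (THE b. b \<in> ell2 \<and>
     (\<lambda>N. ell2_norm (\<lambda>x. (\<Sum>n<N. (A ^^ n) a x / fact n) - b x)) \<longlonglongrightarrow> 0)"

definition walk_prob :: "real \<Rightarrow> (real \<Rightarrow> real) \<Rightarrow> int \<Rightarrow> real" where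
  "walk_prob t k x =
     (cmod (ell2_inner (op_exp (\<lambda>a y. \<i> * of_real t * H_hat k a y) (ket 0)) (ket x)))\<^sup>2"

text \<open>
  The sum of Dirac masses \<open>\<Sum>x. p\<^sub>t(k;x) \<delta>\<^bsub>x/t\<^esub>\<close>, as the image of the measure with point masses
  \<open>p\<^sub>t(k;x)\<close> on the integers under \<open>x \<mapsto> x/t\<close>.
\<close>

definition walk_measure :: "real \<Rightarrow> (real \<Rightarrow> real) \<Rightarrow> real measure" where
  "walk_measure t k =
     distr (point_measure UNIV (\<lambda>x. ennreal (walk_prob t k x))) borel (\<lambda>x. of_int x / t)"

text \<open>
  Weak convergence of Borel probability measures on the real line. The library notion
  \<open>weak_conv_m\<close> only covers sequences, whereas here the index is a real parameter.
\<close>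

definition weak_lim :: "('i \<Rightarrow> real measure) \<Rightarrow> real measure \<Rightarrow> 'i filter \<Rightarrow> bool" where
  "weak_lim \<mu> M F \<longleftrightarrow>
     real_distribution M \<and> eventually (\<lambda>t. real_distribution (\<mu> t)) F \<and>
     (\<forall>f :: real \<Rightarrow> real. continuous_on UNIV f \<and> bounded (range f) \<longrightarrow>
        ((\<lambda>t. LINT x|\<mu> t. f x) \<longlongrightarrow> (LINT x|M. f x)) F)"

definition \<psi>\<^sub>0 :: "real \<Rightarrow> real" where
  "\<psi>\<^sub>0 \<theta> = cos \<theta>"

definition \<phi> :: "real \<Rightarrow> real \<Rightarrow> real" where
  "\<phi> s \<theta> = arccos (s * cos \<theta>)"

definition \<psi> :: "real \<Rightarrow> real \<Rightarrow> real" where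
  "\<psi> s \<theta> = 1 / arcsin s * arcsin (s * cos \<theta>)"

end

theory Submission
  imports Defs
begin

text \<open>
  The Fourier transform turns the walk generated by \<open>k\<close> into multiplication by \<open>k\<close>, so that
  \<open>p\<^sub>t(k;x)\<close> is the squared modulus of the \<open>x\<close>-th Fourier coefficient of the phase function
  \<open>u = e\<^bsup>itk\<^esup>\<close> (lemma \<open>walk_prob_eq\<close>). Multiplying the \<open>x\<close>-th coefficient by \<open>e\<^bsup>i\<xi>x/t\<^esup>\<close>
  amounts to translating \<open>u\<close> by \<open>\<xi>/t\<close>. By Parseval's identity the characteristic function of the
  rescaled walk at \<open>\<xi>\<close> is therefore the mean over the circle of
  \<open>exp (i t (k(\<theta> + \<xi>/t) - k(\<theta>)))\<close> (lemma \<open>char_walk_measure\<close>).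

  If \<open>k\<close> is differentiable, the exponent tends to \<open>i \<xi> k'(\<theta>)\<close> for each \<open>\<theta>\<close>, and the integrand
  has modulus 1. By dominated convergence and Levy's continuity theorem, the rescaled walk
  converges weakly to the law of the group velocity \<open>k'(\<theta>)\<close> for a uniformly distributed \<open>\<theta>\<close>
  (theorem \<open>weak_lim_walk_measure\<close>).

  It remains to compute the law of \<open>k'\<close> in three cases. Each \<open>k'\<close> is, up to sign and scale, a
  function that increases on a half circle and is symmetric about its ends, so the change of
  variables \<open>x = k'(\<theta>)\<close> on that half circle gives the density (theorem
  \<open>distr_circle_measure_eq_density\<close>).

  Two points of the encoding need work. An element of \<open>L\<^sup>2(S\<^sup>1)\<close> is a function, and the adjoint of the
  Fourier transform is only a choice of a representative; for a continuous periodic \<open>h\<close> it is shown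
  that the representative chosen for the coefficients of \<open>h\<close> agrees with \<open>h\<close> almost everywhere.
  Also, Parseval's identity must be available when one of the two functions is an arbitrary square
  integrable one, because the adjoint is characterised by pairing against all of these. It is enough
  that the other one is continuous, and for such functions it follows from the uniform density of
  the trigonometric polynomials.
\<close>

section \<open>The uniform measure on the circle\<close>

lemma sets_circle_measure [measurable_cong, simp]: "sets circle_measure = sets borel"
  by (simp add: circle_measure_def)

lemma space_circle_measure [simp]: "space circle_measure = UNIV"
  by (simp add: circle_measure_def)

lemma emeasure_lborel_circle: "emeasure lborel {0..2 * pi} = ennreal (2 * pi)"
  by simp

lemma prob_space_circle_measure: "prob_space circle_measure"
  unfolding circle_measure_def by (rule prob_space_uniform_measure) auto

interpretation circle: prob_space circle_measure
  by (rule prob_space_circle_measure)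

lemma nn_integral_circle_measure:
  assumes "f \<in> borel_measurable borel"
  shows "(\<integral>\<^sup>+\<theta>. f \<theta> \<partial>circle_measure)
           = (\<integral>\<^sup>+\<theta>. f \<theta> * indicator {0..2 * pi} \<theta> \<partial>lborel) / ennreal (2 * pi)"
  unfolding circle_measure_def using assms
  by (subst nn_integral_uniform_measure) auto

lemma nn_integral_translate:
  fixes f :: "real \<Rightarrow> ennreal"
  assumes [measurable]: "f \<in> borel_measurable borel"
  shows "(\<integral>\<^sup>+\<theta>. f (\<theta> + c) * indicator {a..<b} \<theta> \<partial>lborel)
           = (\<integral>\<^sup>+\<theta>. f \<theta> * indicator {a + c..<b + c} \<theta> \<partial>lborel)"
proof -
  have "(\<integral>\<^sup>+\<theta>. f \<theta> * indicator {a + c..<b + c} \<theta> \<partial>lborel)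
          = (\<integral>\<^sup>+\<theta>. f (c + 1 * \<theta>) * indicator {a + c..<b + c} (c + 1 * \<theta>) \<partial>lborel)"
    by (subst nn_integral_real_affine[where c = 1 and t = c]) auto
  also have "\<dots> = (\<integral>\<^sup>+\<theta>. f (\<theta> + c) * indicator {a..<b} \<theta> \<partial>lborel)"
    by (intro nn_integral_cong) (auto simp: indicator_def add.commute)
  finally show ?thesis by simp
qed

lemma nn_integral_split:
  fixes f :: "real \<Rightarrow> ennreal"
  assumes [measurable]: "f \<in> borel_measurable borel" and "a \<le> b" "b \<le> c"
  shows "(\<integral>\<^sup>+\<theta>. f \<theta> * indicator {a..<c} \<theta> \<partial>lborel)
           = (\<integral>\<^sup>+\<theta>. f \<theta> * indicator {a..<b} \<theta> \<partial>lborel)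
             + (\<integral>\<^sup>+\<theta>. f \<theta> * indicator {b..<c} \<theta> \<partial>lborel)"
proof -
  have "(\<integral>\<^sup>+\<theta>. f \<theta> * indicator {a..<b} \<theta> \<partial>lborel) + (\<integral>\<^sup>+\<theta>. f \<theta> * indicator {b..<c} \<theta> \<partial>lborel)
     = (\<integral>\<^sup>+\<theta>. f \<theta> * indicator {a..<b} \<theta> + f \<theta> * indicator {b..<c} \<theta> \<partial>lborel)"
    by (subst nn_integral_add) auto
  also have "\<dots> = (\<integral>\<^sup>+\<theta>. f \<theta> * indicator {a..<c} \<theta> \<partial>lborel)"
    using assms(2,3) by (intro nn_integral_cong) (auto simp: indicator_def)
  finally show ?thesis by simp
qed

text \<open>
  Shifting by a whole number of periods moves the window to one that starts in \<open>[0, 2\<pi>]\<close>; the part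
  of that window beyond \<open>2\<pi>\<close> is then moved back by one period.
\<close>

lemma nn_integral_period:
  fixes f :: "real \<Rightarrow> ennreal"
  assumes [measurable]: "f \<in> borel_measurable borel" and per: "\<And>\<theta>. f (\<theta> + 2 * pi) = f \<theta>"
  shows "(\<integral>\<^sup>+\<theta>. f \<theta> * indicator {c..<c + 2 * pi} \<theta> \<partial>lborel)
           = (\<integral>\<^sup>+\<theta>. f \<theta> * indicator {0..<2 * pi} \<theta> \<partial>lborel)"
proof -
  let ?J = "\<lambda>a b. \<integral>\<^sup>+\<theta>. f \<theta> * indicator {a..<b} \<theta> \<partial>lborel"
  interpret periodic_fun_simple f "2 * pi" by standard (rule per)
  have shift: "?J (a + of_int n * (2 * pi)) (b + of_int n * (2 * pi)) = ?J a b" for a b n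
    using nn_integral_translate[of f "of_int n * (2 * pi)" a b] by (simp add: plus_of_int)
  define n where "n = \<lfloor>c / (2 * pi)\<rfloor>"
  define d where "d = c - of_int n * (2 * pi)"
  have "of_int n \<le> c / (2 * pi)" "c / (2 * pi) \<le> of_int n + 1"
    unfolding n_def by linarith+
  then have d: "0 \<le> d" "d \<le> 2 * pi"
    using pi_gt_zero by (auto simp: d_def field_simps)
  have "?J c (c + 2 * pi) = ?J d (d + 2 * pi)"
    using shift[of d n "d + 2 * pi"] by (simp add: d_def algebra_simps)
  also have "\<dots> = ?J d (2 * pi) + ?J (2 * pi) (d + 2 * pi)"
    using d by (intro nn_integral_split) auto
  also have "?J (2 * pi) (d + 2 * pi) = ?J 0 d"
    using shift[of 0 1 d] by simp
  also have "?J d (2 * pi) + ?J 0 d = ?J 0 (2 * pi)"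
    using d nn_integral_split[of f 0 d "2 * pi"] by (simp add: add.commute)
  finally show ?thesis .
qed

lemma nn_integral_Icc_Ico:
  "(\<integral>\<^sup>+\<theta>. f \<theta> * indicator {a..b} \<theta> \<partial>lborel) = (\<integral>\<^sup>+\<theta>. f \<theta> * indicator {a..<b} \<theta> \<partial>lborel)" for a b :: real
proof (rule nn_integral_cong_AE)
  have "AE \<theta> in lborel. \<theta> \<noteq> b" by (rule AE_lborel_singleton)
  then show "AE \<theta> in lborel. f \<theta> * indicator {a..b} \<theta> = f \<theta> * indicator {a..<b} \<theta>"
    by eventually_elim (auto simp: indicator_def)
qed

lemma nn_integral_circle_measure_translate:
  fixes f :: "real \<Rightarrow> ennreal"
  assumes [measurable]: "f \<in> borel_measurable borel" and per: "\<And>\<theta>. f (\<theta> + 2 * pi) = f \<theta>"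
  shows "(\<integral>\<^sup>+\<theta>. f (\<theta> + c) \<partial>circle_measure) = (\<integral>\<^sup>+\<theta>. f \<theta> \<partial>circle_measure)"
  using nn_integral_translate[of f c 0 "2 * pi"] nn_integral_period[OF assms, of c]
  by (simp add: nn_integral_circle_measure nn_integral_Icc_Ico add.commute)

text \<open>
  Stating rotation invariance for laws transfers it at once to integrals of functions with values in
  any Banach space.
\<close>

lemma distr_circle_measure_translate:
  assumes [measurable]: "f \<in> borel_measurable borel" and per: "\<And>\<theta>. f (\<theta> + 2 * pi) = f \<theta>"
  shows "distr circle_measure borel (\<lambda>\<theta>. f (\<theta> + c)) = distr circle_measure borel f"
proof (rule measure_eqI)
  fix A assume "A \<in> sets (distr circle_measure borel (\<lambda>\<theta>. f (\<theta> + c)))"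
  then have [measurable]: "A \<in> sets borel" by simp
  have eq: "emeasure (distr circle_measure borel h) A = (\<integral>\<^sup>+\<theta>. indicator A (h \<theta>) \<partial>circle_measure)"
    if [measurable]: "h \<in> borel_measurable borel" for h :: "real \<Rightarrow> 'a"
  proof -
    have "emeasure (distr circle_measure borel h) A
            = (\<integral>\<^sup>+x. indicator A x \<partial>distr circle_measure borel h)" by simp
    also have "\<dots> = (\<integral>\<^sup>+\<theta>. indicator A (h \<theta>) \<partial>circle_measure)"
      by (subst nn_integral_distr) auto
    finally show ?thesis .
  qed
  have "(\<integral>\<^sup>+\<theta>. indicator A (f (\<theta> + c)) \<partial>circle_measure) = (\<integral>\<^sup>+\<theta>. indicator A (f \<theta>) \<partial>circle_measure)"
    by (rule nn_integral_circle_measure_translate) (auto simp: per)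
  then show "emeasure (distr circle_measure borel (\<lambda>\<theta>. f (\<theta> + c))) A
               = emeasure (distr circle_measure borel f) A"
    by (simp add: eq)
qed simp

lemma integral_circle_measure_translate:
  fixes f :: "real \<Rightarrow> 'a :: {banach, second_countable_topology}"
  assumes [measurable]: "f \<in> borel_measurable borel" and per: "\<And>\<theta>. f (\<theta> + 2 * pi) = f \<theta>"
  shows "(LINT \<theta>|circle_measure. f (\<theta> + c)) = (LINT \<theta>|circle_measure. f \<theta>)"
proof -
  have "(LINT \<theta>|circle_measure. f (\<theta> + c)) = (LINT x|distr circle_measure borel (\<lambda>\<theta>. f (\<theta> + c)). x)"
    by (subst integral_distr) auto
  also have "\<dots> = (LINT \<theta>|circle_measure. f \<theta>)"
    by (subst distr_circle_measure_translate[OF assms], subst integral_distr) auto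
  finally show ?thesis .
qed

text \<open>
  The reflection about \<open>a\<close> makes the two half circles \<open>[a - \<pi>, a]\<close> and \<open>[a, a + \<pi>]\<close> contribute
  equally, and on the second one \<open>g\<close> is increasing. Substituting \<open>x = g(\<theta>)\<close> there turns
  \<open>D(x) dx\<close> into \<open>D(g(\<theta>)) g'(\<theta>) d\<theta> = d\<theta>/\<pi>\<close>. Pulling \<open>D\<close> back, rather than differentiating an
  inverse of \<open>g\<close>, avoids singularities of \<open>D\<close> at the ends of its support: \<open>g\<close> is continuously
  differentiable up to the ends of the half circle, and these form a null set.
\<close>

theorem distr_circle_measure_eq_density:
  fixes g g' D :: "real \<Rightarrow> real"
  assumes per: "\<And>\<theta>. g (\<theta> + 2 * pi) = g \<theta>"
    and refl: "\<And>\<theta>. g (2 * a - \<theta>) = g \<theta>"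
    and deriv: "\<And>\<theta>. (g has_real_derivative g' \<theta>) (at \<theta>)"
    and cont: "continuous_on UNIV g'"
    and nonneg: "\<And>\<theta>. \<theta> \<in> {a..a + pi} \<Longrightarrow> 0 \<le> g' \<theta>"
    and [measurable]: "D \<in> borel_measurable borel"
    and D: "\<And>\<theta>. \<theta> \<in> {a<..<a + pi} \<Longrightarrow> D (g \<theta>) * g' \<theta> = 1 / pi"
    and D0: "\<And>x. x \<notin> {g a..g (a + pi)} \<Longrightarrow> D x = 0"
  shows "distr circle_measure borel g = density lborel (\<lambda>x. ennreal (D x))"
proof (rule measure_eqI)
  fix A assume "A \<in> sets (distr circle_measure borel g)"
  then have A [measurable]: "A \<in> sets borel" by simp
  have contg: "continuous_on UNIV g"
    using deriv by (meson DERIV_isCont continuous_at_imp_continuous_on)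
  have g [measurable]: "g \<in> borel_measurable borel"
    by (rule borel_measurable_continuous_onI[OF contg])
  let ?I = "\<lambda>\<theta>. indicator A (g \<theta>) :: ennreal"
  let ?J = "\<lambda>a b. \<integral>\<^sup>+\<theta>. ?I \<theta> * indicator {a..b} \<theta> \<partial>lborel"
  \<comment> \<open>The substitution \<open>\<theta> \<mapsto> 2a - \<theta>\<close> exchanges the two half circles.\<close>
  have fold: "?J (a - pi) a = ?J a (a + pi)"
  proof -
    have "?J (a - pi) a = (\<integral>\<^sup>+\<theta>. ?I (2 * a + (-1) * \<theta>) * indicator {a - pi..a} (2 * a + (-1) * \<theta>) \<partial>lborel)"
      by (subst nn_integral_real_affine[where c = "-1" and t = "2 * a"]) auto
    also have "\<dots> = ?J a (a + pi)"
      using refl by (intro nn_integral_cong) (auto simp: indicator_def)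
    finally show ?thesis .
  qed
  have "emeasure (distr circle_measure borel g) A = (\<integral>\<^sup>+x. indicator A x \<partial>distr circle_measure borel g)"
    by simp
  also have "\<dots> = (\<integral>\<^sup>+\<theta>. ?I \<theta> \<partial>circle_measure)"
    by (subst nn_integral_distr) auto
  also have "\<dots> = (\<integral>\<^sup>+\<theta>. ?I \<theta> * indicator {a - pi..<a - pi + 2 * pi} \<theta> \<partial>lborel) / ennreal (2 * pi)"
    by (subst nn_integral_period) (auto simp: per nn_integral_circle_measure nn_integral_Icc_Ico)
  also have "(\<integral>\<^sup>+\<theta>. ?I \<theta> * indicator {a - pi..<a - pi + 2 * pi} \<theta> \<partial>lborel) = ?J (a - pi) a + ?J a (a + pi)"
    using nn_integral_split[of ?I "a - pi" a "a + pi"]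
    by (simp add: nn_integral_Icc_Ico add.commute[of pi a])
  also have "\<dots> / ennreal (2 * pi) = ennreal (1 / pi) * ?J a (a + pi)"
  proof -
    have "ennreal (1 / pi) = 2 / ennreal (2 * pi)"
      by (subst ennreal_numeral[symmetric], subst divide_ennreal) auto
    then show ?thesis
      unfolding fold mult_2[symmetric] by (metis ennreal_times_divide mult.commute)
  qed
  also have "\<dots> = (\<integral>\<^sup>+\<theta>. ennreal (1 / pi) * (?I \<theta> * indicator {a..a + pi} \<theta>) \<partial>lborel)"
    by (subst nn_integral_cmult) auto
  also have "\<dots> = (\<integral>\<^sup>+\<theta>. ennreal (D (g \<theta>) * indicator A (g \<theta>) * g' \<theta> * indicator {a..a + pi} \<theta>) \<partial>lborel)"
  proof (rule nn_integral_cong_AE)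
    have "AE \<theta> in lborel. \<theta> \<noteq> a" "AE \<theta> in lborel. \<theta> \<noteq> a + pi"
      by (rule AE_lborel_singleton)+
    then show "AE \<theta> in lborel. ennreal (1 / pi) * (?I \<theta> * indicator {a..a + pi} \<theta>)
                 = ennreal (D (g \<theta>) * indicator A (g \<theta>) * g' \<theta> * indicator {a..a + pi} \<theta>)"
      by eventually_elim (use D in \<open>auto simp: indicator_def split: if_splits\<close>)
  qed
  also have "\<dots> = (\<integral>\<^sup>+x. ennreal (D x * indicator A x * indicator {g a..g (a + pi)} x) \<partial>lborel)"
    by (rule nn_integral_substitution[symmetric])
       (auto simp: set_borel_measurable_def intro: deriv nonneg continuous_on_subset[OF cont])
  also have "\<dots> = (\<integral>\<^sup>+x. ennreal (D x) * indicator A x \<partial>lborel)"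
    using D0 by (intro nn_integral_cong) (auto simp: indicator_def)
  also have "\<dots> = emeasure (density lborel (\<lambda>x. ennreal (D x))) A"
    by (subst emeasure_density) auto
  finally show "emeasure (distr circle_measure borel g) A = emeasure (density lborel (\<lambda>x. ennreal (D x))) A" .
qed simp

definition cont_periodic :: "(real \<Rightarrow> complex) \<Rightarrow> bool" where
  "cont_periodic h \<longleftrightarrow> continuous_on UNIV h \<and> (\<forall>\<theta>. h (\<theta> + 2 * pi) = h \<theta>)"

lemma cont_periodicI:
  "continuous_on UNIV h \<Longrightarrow> (\<And>\<theta>. h (\<theta> + 2 * pi) = h \<theta>) \<Longrightarrow> cont_periodic h"
  by (simp add: cont_periodic_def)

section \<open>Square integrable functions on the circle\<close>

lemma borel_measurable_cnj [measurable (raw)]: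
  "f \<in> borel_measurable M \<Longrightarrow> (\<lambda>x. cnj (f x)) \<in> borel_measurable M"
  by (rule measurable_compose[OF _ borel_measurable_continuous_onI]) (auto intro: continuous_intros)

lemma cont_periodic_measurable [measurable_dest]: "cont_periodic h \<Longrightarrow> h \<in> borel_measurable borel"
  by (auto simp: cont_periodic_def intro: borel_measurable_continuous_onI)

lemma cont_periodic_bounded:
  assumes "cont_periodic h"
  obtains B where "\<And>\<theta>. cmod (h \<theta>) \<le> B"
proof -
  interpret periodic_fun_simple h "2 * pi"
    by standard (use assms in \<open>simp add: cont_periodic_def\<close>)
  have "compact (h ` {0..2 * pi})"
    using assms by (intro compact_continuous_image)
      (auto simp: cont_periodic_def intro: continuous_on_subset)
  then obtain B where B: "\<And>\<theta>. \<theta> \<in> {0..2 * pi} \<Longrightarrow> cmod (h \<theta>) \<le> B"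
    by (meson bounded_iff compact_imp_bounded imageI)
  have "cmod (h \<theta>) \<le> B" for \<theta>
  proof -
    define n where "n = \<lfloor>\<theta> / (2 * pi)\<rfloor>"
    have "of_int n \<le> \<theta> / (2 * pi)" "\<theta> / (2 * pi) \<le> of_int n + 1"
      unfolding n_def by linarith+
    then have "\<theta> - of_int n * (2 * pi) \<in> {0..2 * pi}"
      using pi_gt_zero by (auto simp: field_simps)
    from B[OF this] show ?thesis by (simp add: minus_of_int)
  qed
  then show ?thesis by (rule that)
qed

lemma cont_periodic_in_L2_circle:
  assumes "cont_periodic h"
  shows "h \<in> L2_circle"
proof -
  note [measurable] = cont_periodic_measurable[OF assms]
  obtain B where B: "\<And>\<theta>. cmod (h \<theta>) \<le> B" using cont_periodic_bounded[OF assms] by blast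
  have "integrable circle_measure (\<lambda>\<theta>. (cmod (h \<theta>))\<^sup>2)"
    by (rule circle.integrable_const_bound[where B = "B\<^sup>2"]) (auto intro!: AE_I2 power_mono B)
  then show ?thesis
    using assms by (auto simp: L2_circle_def cont_periodic_def intro: borel_measurable_continuous_onI)
qed

lemma L2_circle_measurable [measurable_dest]: "g \<in> L2_circle \<Longrightarrow> g \<in> borel_measurable borel"
  by (simp add: L2_circle_def)

lemma integrable_L2_circle_mult:
  assumes g: "g \<in> L2_circle" and h: "h \<in> L2_circle"
  shows "integrable circle_measure (\<lambda>\<theta>. g \<theta> * cnj (h \<theta>))"
proof (rule Bochner_Integration.integrable_bound)
  note [measurable] = L2_circle_measurable[OF g] L2_circle_measurable[OF h]
  show "integrable circle_measure (\<lambda>\<theta>. (cmod (g \<theta>))\<^sup>2 + (cmod (h \<theta>))\<^sup>2)"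
    using g h by (auto simp: L2_circle_def)
  show "(\<lambda>\<theta>. g \<theta> * cnj (h \<theta>)) \<in> borel_measurable circle_measure"
    by measurable
  have "cmod (g \<theta>) * cmod (h \<theta>) \<le> (cmod (g \<theta>))\<^sup>2 + (cmod (h \<theta>))\<^sup>2" for \<theta>
    using sum_squares_bound[of "cmod (g \<theta>)" "cmod (h \<theta>)"]
      mult_nonneg_nonneg[OF norm_ge_zero[of "g \<theta>"] norm_ge_zero[of "h \<theta>"]] by linarith
  then show "AE \<theta> in circle_measure. norm (g \<theta> * cnj (h \<theta>)) \<le> norm ((cmod (g \<theta>))\<^sup>2 + (cmod (h \<theta>))\<^sup>2)"
    by (auto simp: norm_mult)
qed

lemma L2_circle_add:
  assumes g: "g \<in> L2_circle" and h: "h \<in> L2_circle"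
  shows "(\<lambda>\<theta>. g \<theta> + h \<theta>) \<in> L2_circle"
proof -
  note [measurable] = L2_circle_measurable[OF g] L2_circle_measurable[OF h]
  have "integrable circle_measure (\<lambda>\<theta>. (cmod (g \<theta> + h \<theta>))\<^sup>2)"
  proof (rule Bochner_Integration.integrable_bound)
    show "integrable circle_measure (\<lambda>\<theta>. 2 * (cmod (g \<theta>))\<^sup>2 + 2 * (cmod (h \<theta>))\<^sup>2)"
      using g h by (auto simp: L2_circle_def)
    have "(cmod (g \<theta> + h \<theta>))\<^sup>2 \<le> 2 * (cmod (g \<theta>))\<^sup>2 + 2 * (cmod (h \<theta>))\<^sup>2" for \<theta>
    proof -
      have "(cmod (g \<theta> + h \<theta>))\<^sup>2 \<le> (cmod (g \<theta>) + cmod (h \<theta>))\<^sup>2"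
        by (intro power_mono norm_triangle_ineq) auto
      also have "\<dots> \<le> 2 * (cmod (g \<theta>))\<^sup>2 + 2 * (cmod (h \<theta>))\<^sup>2"
        using sum_squares_bound[of "cmod (g \<theta>)" "cmod (h \<theta>)"] by (simp add: power2_sum)
      finally show ?thesis .
    qed
    then show "AE \<theta> in circle_measure. norm ((cmod (g \<theta> + h \<theta>))\<^sup>2)
                 \<le> norm (2 * (cmod (g \<theta>))\<^sup>2 + 2 * (cmod (h \<theta>))\<^sup>2)"
      by auto
  qed measurable
  then show ?thesis
    using g h by (simp add: L2_circle_def)
qed

lemma L2_circle_cmult:
  assumes "g \<in> L2_circle"
  shows "(\<lambda>\<theta>. c * g \<theta>) \<in> L2_circle"
  using assms by (auto simp: L2_circle_def norm_mult power_mult_distrib)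

lemma L2_circle_diff:
  assumes g: "g \<in> L2_circle" and h: "h \<in> L2_circle"
  shows "(\<lambda>\<theta>. g \<theta> - h \<theta>) \<in> L2_circle"
  using L2_circle_add[OF g L2_circle_cmult[OF h, of "-1"]] by simp

lemma L2_inner_diff_left:
  assumes "f \<in> L2_circle" "g \<in> L2_circle" "h \<in> L2_circle"
  shows "L2_inner (\<lambda>\<theta>. f \<theta> - g \<theta>) h = L2_inner f h - L2_inner g h"
  using assms by (simp add: L2_inner_def algebra_simps integrable_L2_circle_mult)

lemma L2_inner_diff_right:
  assumes "f \<in> L2_circle" "g \<in> L2_circle" "h \<in> L2_circle"
  shows "L2_inner f (\<lambda>\<theta>. g \<theta> - h \<theta>) = L2_inner f g - L2_inner f h"
  using assms by (simp add: L2_inner_def algebra_simps integrable_L2_circle_mult)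

lemma L2_inner_cnj: "cnj (L2_inner g h) = L2_inner h g"
  unfolding L2_inner_def by (subst Bochner_Integration.integral_cnj[symmetric]) (simp add: mult.commute)

lemma L2_inner_self: "L2_inner g g = of_real (LINT \<theta>|circle_measure. (cmod (g \<theta>))\<^sup>2)"
  unfolding L2_inner_def complex_norm_square[symmetric] by (rule integral_complex_of_real)

section \<open>Fourier coefficients and the Bessel identity\<close>

definition expi :: "int \<Rightarrow> real \<Rightarrow> complex" where
  "expi x \<theta> = cis (of_int x * \<theta>)"

lemma expi_shift: "expi x (\<theta> + c) = expi x c * expi x \<theta>"
  by (simp add: expi_def cis_mult algebra_simps)

lemma expi_add: "expi (x + y) \<theta> = expi x \<theta> * expi y \<theta>"
  by (simp add: expi_def cis_mult algebra_simps)

lemma cnj_expi: "cnj (expi x \<theta>) = expi (- x) \<theta>"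
  by (simp add: expi_def cis_cnj)

lemma cont_periodic_expi: "cont_periodic (expi x)"
proof (rule cont_periodicI)
  show "continuous_on UNIV (expi x)" unfolding expi_def by (intro continuous_intros)
  have "expi x (2 * pi) = 1"
    using cis_multiple_2pi[of "of_int x"] by (simp add: expi_def mult.commute mult.left_commute)
  then show "expi x (\<theta> + 2 * pi) = expi x \<theta>" for \<theta> by (simp add: expi_shift)
qed

lemmas expi_in_L2 = cont_periodic_in_L2_circle[OF cont_periodic_expi]

lemma fourier_eq_L2_inner:
  assumes [measurable]: "f \<in> borel_measurable borel"
  shows "fourier f x = L2_inner f (expi x)"
proof -
  have [measurable]: "expi x \<in> borel_measurable borel"
    by (rule cont_periodic_measurable[OF cont_periodic_expi])
  have cnj_expi_exp: "cnj (expi x \<theta>) = exp (- \<i> * of_int x * of_real \<theta>)" for \<theta>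
    unfolding cnj_expi by (simp add: expi_def cis_conv_exp mult.assoc)
  have "circle_measure = density lborel (\<lambda>\<theta>. ennreal (indicator {0..2 * pi} \<theta> / (2 * pi)))"
    unfolding circle_measure_def uniform_measure_def emeasure_lborel_circle
    by (intro density_cong) (auto simp: indicator_def divide_ennreal simp flip: ennreal_1)
  then have "L2_inner f (expi x)
      = (LINT \<theta>|lborel. (indicator {0..2 * pi} \<theta> / (2 * pi)) *\<^sub>R (f \<theta> * cnj (expi x \<theta>)))"
    unfolding L2_inner_def by (elim ssubst) (subst integral_density, auto)
  also have "\<dots> = (LINT \<theta>|lborel. of_real (1 / (2 * pi)) *
        (indicator {0..2 * pi} \<theta> *\<^sub>R (exp (- \<i> * of_int x * of_real \<theta>) * f \<theta>)))"
    by (intro Bochner_Integration.integral_cong)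
       (auto simp: indicator_def cnj_expi_exp scaleR_conv_of_real mult_ac)
  also have "\<dots> = fourier f x"
    unfolding fourier_def set_lebesgue_integral_def by (subst integral_mult_right_zero) simp
  finally show ?thesis by simp
qed

lemma fourier_L2: "g \<in> L2_circle \<Longrightarrow> fourier g x = L2_inner g (expi x)"
  by (intro fourier_eq_L2_inner L2_circle_measurable)

text \<open>
  Translating by \<open>\<pi>/x\<close>, that is, by half a period of \<open>e\<^bsup>ix\<theta>\<^esup>\<close>, changes the sign of the integrand but
  not the integral.
\<close>

lemma integral_expi: "(LINT \<theta>|circle_measure. expi x \<theta>) = (if x = 0 then 1 else 0)"
proof (cases "x = 0")
  case True
  then show ?thesis using circle.prob_space by (simp add: expi_def)
next
  case False
  let ?I = "LINT \<theta>|circle_measure. expi x \<theta>"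
  have "?I = (LINT \<theta>|circle_measure. expi x (\<theta> + pi / of_int x))"
    using cont_periodic_expi[of x] cont_periodic_measurable[OF cont_periodic_expi]
    by (subst integral_circle_measure_translate) (auto simp: cont_periodic_def)
  also have "\<dots> = - ?I"
    using False by (simp add: expi_shift) (simp add: expi_def)
  finally show ?thesis using False by simp
qed

lemma L2_inner_expi: "L2_inner (expi x) (expi y) = (if x = y then 1 else 0)"
  unfolding L2_inner_def cnj_expi expi_add[symmetric] by (simp add: integral_expi)

definition fourier_sum :: "int set \<Rightarrow> (real \<Rightarrow> complex) \<Rightarrow> real \<Rightarrow> complex" where
  "fourier_sum G h \<theta> = (\<Sum>x\<in>G. fourier h x * expi x \<theta>)"

lemma fourier_sum_in_L2: "fourier_sum G h \<in> L2_circle"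
proof (induction G rule: infinite_finite_induct)
  case (insert x G)
  from L2_circle_add[OF L2_circle_cmult[OF expi_in_L2] this(3), of "fourier h x" x]
  show ?case using insert by (simp add: fourier_sum_def [abs_def])
qed (use cont_periodic_in_L2_circle[of "\<lambda>_. 0"] in \<open>auto simp: fourier_sum_def [abs_def] cont_periodic_def\<close>)

lemma L2_inner_fourier_sum_left:
  assumes "g \<in> L2_circle"
  shows "L2_inner (fourier_sum G h) g = (\<Sum>x\<in>G. fourier h x * L2_inner (expi x) g)"
proof -
  have "L2_inner (fourier_sum G h) g
          = (LINT \<theta>|circle_measure. (\<Sum>x\<in>G. fourier h x * (expi x \<theta> * cnj (g \<theta>))))"
    unfolding L2_inner_def fourier_sum_def by (simp add: sum_distrib_right mult.assoc)
  also have "\<dots> = (\<Sum>x\<in>G. fourier h x * L2_inner (expi x) g)"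
    unfolding L2_inner_def
    by (subst Bochner_Integration.integral_sum)
       (simp_all add: integrable_L2_circle_mult expi_in_L2 assms)
  finally show ?thesis .
qed

lemma L2_inner_fourier_sum_right:
  assumes "g \<in> L2_circle"
  shows "L2_inner g (fourier_sum G h) = (\<Sum>x\<in>G. fourier g x * cnj (fourier h x))"
proof -
  have "L2_inner g (fourier_sum G h) = cnj (L2_inner (fourier_sum G h) g)" by (simp add: L2_inner_cnj)
  also have "\<dots> = (\<Sum>x\<in>G. fourier g x * cnj (fourier h x))"
    by (simp add: L2_inner_fourier_sum_left assms L2_inner_cnj fourier_L2 mult.commute)
  finally show ?thesis .
qed

text \<open>
  The remainder \<open>h - S\<close>, where \<open>S\<close> is the partial Fourier sum over \<open>G\<close>, is orthogonal to every
  \<open>e\<^sub>x\<close> with \<open>x \<in> G\<close>, hence to \<open>S\<close> itself.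
\<close>

lemma bessel_identity:
  assumes h: "h \<in> L2_circle" and "finite G"
  shows "(LINT \<theta>|circle_measure. (cmod (h \<theta> - fourier_sum G h \<theta>))\<^sup>2)
           = (LINT \<theta>|circle_measure. (cmod (h \<theta>))\<^sup>2) - (\<Sum>x\<in>G. (cmod (fourier h x))\<^sup>2)"
proof -
  let ?S = "fourier_sum G h" and ?u = "\<lambda>\<theta>. h \<theta> - fourier_sum G h \<theta>"
  note S = fourier_sum_in_L2[of G h]
  note u = L2_circle_diff[OF h S]
  have fourier_S: "L2_inner (expi x) ?S = cnj (fourier h x)" if "x \<in> G" for x
    using that \<open>finite G\<close>
    by (subst L2_inner_fourier_sum_right[OF expi_in_L2])
       (simp add: fourier_L2 expi_in_L2 L2_inner_expi if_distrib[of "\<lambda>z. z * _"] sum.delta cong: if_cong)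
  have "L2_inner (expi x) ?u = 0" if "x \<in> G" for x
    by (simp add: L2_inner_diff_right expi_in_L2 h S fourier_S[OF that] fourier_L2[OF h] L2_inner_cnj)
  then have "L2_inner ?S ?u = 0"
    by (simp add: L2_inner_fourier_sum_left[OF u])
  then have "L2_inner ?u ?u = L2_inner h h - L2_inner h ?S"
    by (simp add: L2_inner_diff_left h S u) (simp add: L2_inner_diff_right h S)
  also have "L2_inner h ?S = of_real (\<Sum>x\<in>G. (cmod (fourier h x))\<^sup>2)"
    unfolding of_real_sum complex_norm_square by (rule L2_inner_fourier_sum_right[OF h])
  finally show ?thesis
    unfolding L2_inner_self of_real_diff[symmetric] of_real_eq_iff .
qed

section \<open>Density of the trigonometric polynomials\<close>

text \<open>
  Generating the trigonometric polynomials by sums of monomials gives direct inductions, with no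
  bookkeeping for finite sets of frequencies and their coefficients.
\<close>

inductive trig_polynomial :: "(real \<Rightarrow> complex) \<Rightarrow> bool" where
  monomial: "trig_polynomial (\<lambda>\<theta>. c * expi x \<theta>)"
| add: "trig_polynomial p \<Longrightarrow> trig_polynomial q \<Longrightarrow> trig_polynomial (\<lambda>\<theta>. p \<theta> + q \<theta>)"

lemma trig_polynomial_const: "trig_polynomial (\<lambda>_. c)"
  using trig_polynomial.monomial[of c 0] by (simp add: expi_def)

lemma trig_polynomial_monomial_mult:
  "trig_polynomial q \<Longrightarrow> trig_polynomial (\<lambda>\<theta>. c * expi x \<theta> * q \<theta>)"
proof (induction rule: trig_polynomial.induct)
  case (monomial d y)
  show ?case using trig_polynomial.monomial[of "c * d" "x + y"] by (simp add: expi_add mult_ac)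
next
  case (add p q)
  then show ?case using trig_polynomial.add by (fastforce simp: distrib_left)
qed

lemma trig_polynomial_mult:
  "trig_polynomial p \<Longrightarrow> trig_polynomial q \<Longrightarrow> trig_polynomial (\<lambda>\<theta>. p \<theta> * q \<theta>)"
proof (induction rule: trig_polynomial.induct)
  case (monomial c x)
  then show ?case by (rule trig_polynomial_monomial_mult)
next
  case (add p p')
  then show ?case using trig_polynomial.add by (fastforce simp: distrib_right)
qed

lemma trig_polynomial_cis_Re: "trig_polynomial (\<lambda>\<theta>. of_real (Re (cis \<theta>)))"
proof -
  have "of_real (Re (cis \<theta>)) = 1/2 * expi 1 \<theta> + 1/2 * expi (- 1) \<theta>" for \<theta>
    by (simp add: complex_eq_iff expi_def)
  then show ?thesis using trig_polynomial.intros by presburger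
qed

lemma trig_polynomial_cis_Im: "trig_polynomial (\<lambda>\<theta>. of_real (Im (cis \<theta>)))"
proof -
  have "of_real (Im (cis \<theta>)) = - \<i>/2 * expi 1 \<theta> + \<i>/2 * expi (- 1) \<theta>" for \<theta>
    by (simp add: complex_eq_iff expi_def)
  then show ?thesis using trig_polynomial.intros by presburger
qed

lemma trig_polynomial_real_polynomial_cis:
  fixes p :: "complex \<Rightarrow> real"
  assumes "real_polynomial_function p"
  shows "trig_polynomial (\<lambda>\<theta>. of_real (p (cis \<theta>)))"
  using assms
proof (induction rule: real_polynomial_function.induct)
  case (linear f)
  interpret bounded_linear f by fact
  have "f z = Re z * f 1 + Im z * f \<i>" for z
  proof -
    have "f z = f (Re z *\<^sub>R 1 + Im z *\<^sub>R \<i>)"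
      by (rule arg_cong[where f = f]) (simp add: complex_eq_iff)
    then show ?thesis unfolding add scaleR by simp
  qed
  then have "of_real (f (cis \<theta>))
      = of_real (Re (cis \<theta>)) * of_real (f 1) + of_real (Im (cis \<theta>)) * complex_of_real (f \<i>)" for \<theta>
    by (metis of_real_add of_real_mult)
  then show ?case
    by (simp only:) (intro trig_polynomial.add trig_polynomial_mult trig_polynomial_const
        trig_polynomial_cis_Re trig_polynomial_cis_Im)
qed (auto intro: trig_polynomial_const trig_polynomial.add trig_polynomial_mult)

lemma trig_polynomial_polynomial_cis:
  fixes p :: "complex \<Rightarrow> complex"
  assumes "polynomial_function p"
  shows "trig_polynomial (\<lambda>\<theta>. p (cis \<theta>))"
proof -
  have "real_polynomial_function (Re \<circ> p)" "real_polynomial_function (Im \<circ> p)"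
    using assms bounded_linear_Re bounded_linear_Im by (auto simp: polynomial_function_def)
  then have "trig_polynomial (\<lambda>\<theta>. of_real (Re (p (cis \<theta>))) + \<i> * of_real (Im (p (cis \<theta>))))"
    by (intro trig_polynomial.add trig_polynomial_mult trig_polynomial_const)
       (auto dest: trig_polynomial_real_polynomial_cis)
  then show ?thesis by (simp flip: complex_eq)
qed

text \<open>
  Neither branch of the argument is continuous on the whole circle, but \<open>Arg\<close> is continuous off the
  negative axis and \<open>Arg2pi\<close> off the positive one, and composing \<open>h\<close> with either of them gives the
  same function. So this function is continuous everywhere on the circle.
\<close>

lemma cont_periodic_factors_through_circle:
  assumes h: "cont_periodic h"
  obtains H where "continuous_on (sphere 0 1) H" "\<And>\<theta>. h \<theta> = H (cis \<theta>)"
proof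
  interpret periodic_fun_simple h "2 * pi"
    by standard (use assms in \<open>simp add: cont_periodic_def\<close>)
  have cont: "isCont h \<theta>" for \<theta>
    using h by (simp add: cont_periodic_def continuous_on_eq_continuous_at)
  have cis_eq: "h \<alpha> = h \<beta>" if "cis \<alpha> = cis \<beta>" for \<alpha> \<beta>
  proof -
    from that have "sin \<alpha> = sin \<beta> \<and> cos \<alpha> = cos \<beta>" by (simp add: complex_eq_iff)
    then obtain n :: int where "\<alpha> = \<beta> + 2 * pi * n" unfolding sin_cos_eq_iff by auto
    then show ?thesis using plus_of_int[of \<beta> n] by (simp add: mult_ac)
  qed
  have Arg_eq: "h (Arg z) = h (Arg2pi z)" if "z \<noteq> 0" for z
  proof (rule cis_eq)
    have "of_real (cmod z) * cis (Arg2pi z) = z"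
      using Arg2pi_eq[of z] by (simp add: cis_conv_exp)
    then show "cis (Arg z) = cis (Arg2pi z)"
      using that by (simp add: cis_Arg sgn_eq field_simps)
  qed
  show "continuous_on (sphere 0 1) (\<lambda>z. h (Arg z))"
  proof (rule continuous_at_imp_continuous_on, rule ballI)
    fix z :: complex assume "z \<in> sphere 0 1"
    then have "z \<noteq> 0" by auto
    show "isCont (\<lambda>z. h (Arg z)) z"
    proof (cases "z \<in> \<real>\<^sub>\<le>\<^sub>0")
      case False
      then show ?thesis by (intro isCont_o2[OF continuous_at_Arg cont])
    next
      case True
      then have "z \<notin> \<real>\<^sub>\<ge>\<^sub>0" using \<open>z \<noteq> 0\<close>
        by (auto simp: complex_nonpos_Reals_iff complex_nonneg_Reals_iff complex_eq_iff)
      then have "isCont (\<lambda>z. h (Arg2pi z)) z"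
        by (intro isCont_o2[OF continuous_at_Arg2pi cont])
      moreover have "\<forall>\<^sub>F w in nhds z. h (Arg w) = h (Arg2pi w)"
        using t1_space_nhds[OF \<open>z \<noteq> 0\<close>] by eventually_elim (rule Arg_eq)
      ultimately show ?thesis by (simp add: isCont_cong)
    qed
  qed
  show "h \<theta> = h (Arg (cis \<theta>))" for \<theta>
    by (rule cis_eq) (simp add: cis_Arg sgn_eq)
qed

text \<open>
  Stone-Weierstrass on the unit circle: a real polynomial in the coordinates of \<open>e\<^bsup>i\<theta>\<^esup>\<close> is a
  trigonometric polynomial in \<open>\<theta>\<close>.
\<close>

lemma trig_polynomials_dense:
  assumes h: "cont_periodic h" and "\<epsilon> > 0"
  obtains p where "trig_polynomial p" "\<And>\<theta>. cmod (h \<theta> - p \<theta>) < \<epsilon>"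
proof -
  obtain H where H: "continuous_on (sphere 0 1) H" "\<And>\<theta>. h \<theta> = H (cis \<theta>)"
    using cont_periodic_factors_through_circle[OF h] by blast
  obtain q where q: "polynomial_function q" "\<And>z. z \<in> sphere 0 1 \<Longrightarrow> norm (H z - q z) < \<epsilon>"
    using Stone_Weierstrass_polynomial_function[OF compact_sphere H(1) \<open>\<epsilon> > 0\<close>] by blast
  show ?thesis
    by (rule that[OF trig_polynomial_polynomial_cis[OF q(1)]]) (simp add: H(2) q(2))
qed

lemma trig_polynomial_cont_periodic: "trig_polynomial p \<Longrightarrow> cont_periodic p"
proof (induction rule: trig_polynomial.induct)
  case (monomial c x)
  then show ?case using cont_periodic_expi[of x] by (auto simp: cont_periodic_def intro!: continuous_intros)
next
  case (add p q)
  then show ?case by (auto simp: cont_periodic_def intro!: continuous_intros)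
qed

section \<open>Parseval identity\<close>

lemma L2_inner_add_left:
  assumes "f \<in> L2_circle" "g \<in> L2_circle" "h \<in> L2_circle"
  shows "L2_inner (\<lambda>\<theta>. f \<theta> + g \<theta>) h = L2_inner f h + L2_inner g h"
  using assms by (simp add: L2_inner_def algebra_simps integrable_L2_circle_mult)

lemma L2_inner_cmult_left: "L2_inner (\<lambda>\<theta>. c * g \<theta>) h = c * L2_inner g h"
  by (simp add: L2_inner_def mult.assoc)

lemma fourier_add:
  assumes "f \<in> L2_circle" "g \<in> L2_circle"
  shows "fourier (\<lambda>\<theta>. f \<theta> + g \<theta>) x = fourier f x + fourier g x"
  using assms by (simp add: fourier_L2 L2_circle_add L2_inner_add_left expi_in_L2)

lemma fourier_diff:
  assumes "f \<in> L2_circle" "g \<in> L2_circle"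
  shows "fourier (\<lambda>\<theta>. f \<theta> - g \<theta>) x = fourier f x - fourier g x"
  using assms by (simp add: fourier_L2 L2_circle_diff L2_inner_diff_left expi_in_L2)

lemma fourier_cmult:
  assumes "g \<in> L2_circle"
  shows "fourier (\<lambda>\<theta>. c * g \<theta>) x = c * fourier g x"
  using assms by (simp add: fourier_L2 L2_circle_cmult L2_inner_cmult_left)

lemma fourier_expi: "fourier (expi y) x = (if y = x then 1 else 0)"
  by (simp add: fourier_L2 expi_in_L2 L2_inner_expi)

lemma fourier_sum_trig_polynomial:
  "trig_polynomial p \<Longrightarrow> \<forall>\<^sub>F G in finite_subsets_at_top UNIV. finite G \<and> fourier_sum G p = p"
proof (induction rule: trig_polynomial.induct)
  case (monomial c x)
  have "\<forall>\<^sub>F G in finite_subsets_at_top UNIV. finite G \<and> x \<in> G"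
    unfolding eventually_finite_subsets_at_top by (intro exI[of _ "{x}"]) auto
  then show ?case
    by eventually_elim
       (auto simp: fourier_sum_def fun_eq_iff fourier_cmult expi_in_L2 fourier_expi
          if_distrib[of "\<lambda>z. _ * z"] if_distrib[of "\<lambda>z. z * _"] cong: if_cong)
next
  case (add p q)
  have "p \<in> L2_circle" "q \<in> L2_circle"
    using add by (auto intro: cont_periodic_in_L2_circle trig_polynomial_cont_periodic)
  then have "fourier_sum G (\<lambda>\<theta>. p \<theta> + q \<theta>) = (\<lambda>\<theta>. fourier_sum G p \<theta> + fourier_sum G q \<theta>)" for G
    by (simp add: fourier_sum_def fun_eq_iff fourier_add distrib_right sum.distrib)
  moreover from add.IH have "\<forall>\<^sub>F G in finite_subsets_at_top UNIV.
      (finite G \<and> fourier_sum G p = p) \<and> (finite G \<and> fourier_sum G q = q)"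
    by (rule eventually_conj)
  ultimately show ?case
    by (elim eventually_mono) auto
qed

text \<open>
  For a trigonometric polynomial \<open>p\<close>, the partial Fourier sums over all large enough \<open>G\<close> reproduce
  \<open>p\<close>. The remainder of \<open>h\<close> is then the remainder of \<open>h - p\<close>, which by the Bessel identity is no
  larger in \<open>L\<^sup>2\<close> than \<open>h - p\<close> itself.
\<close>

lemma fourier_sum_tendsto_L2:
  assumes h: "cont_periodic h"
  shows "((\<lambda>G. LINT \<theta>|circle_measure. (cmod (h \<theta> - fourier_sum G h \<theta>))\<^sup>2) \<longlongrightarrow> 0)
           (finite_subsets_at_top UNIV)"
proof (rule tendstoI)
  fix e :: real assume "e > 0"
  \<comment> \<open>The error is measured by a squared norm, so uniform closeness \<open>sqrt (e / 2)\<close> gives \<open>e / 2\<close>.\<close>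
  define \<epsilon> where "\<epsilon> = sqrt (e / 2)"
  have \<epsilon>: "\<epsilon> > 0" "\<epsilon>\<^sup>2 = e / 2" using \<open>e > 0\<close> by (auto simp: \<epsilon>_def)
  obtain p where p: "trig_polynomial p" "\<And>\<theta>. cmod (h \<theta> - p \<theta>) < \<epsilon>"
    using trig_polynomials_dense[OF h \<open>\<epsilon> > 0\<close>] by blast
  let ?u = "\<lambda>\<theta>. h \<theta> - p \<theta>"
  have hL: "h \<in> L2_circle" and pL: "p \<in> L2_circle"
    using h p by (auto intro: cont_periodic_in_L2_circle trig_polynomial_cont_periodic)
  note uL = L2_circle_diff[OF hL pL]
  have u_le: "(LINT \<theta>|circle_measure. (cmod (?u \<theta>))\<^sup>2) \<le> \<epsilon>\<^sup>2"
  proof -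
    have "(LINT \<theta>|circle_measure. (cmod (?u \<theta>))\<^sup>2) \<le> (LINT \<theta>|circle_measure. \<epsilon>\<^sup>2)"
      using uL by (intro integral_mono power_mono less_imp_le[OF p(2)]) (auto simp: L2_circle_def)
    then show ?thesis using circle.prob_space by simp
  qed
  from fourier_sum_trig_polynomial[OF p(1)]
  show "\<forall>\<^sub>F G in finite_subsets_at_top UNIV.
          dist (LINT \<theta>|circle_measure. (cmod (h \<theta> - fourier_sum G h \<theta>))\<^sup>2) 0 < e"
  proof eventually_elim
    case (elim G)
    have "fourier_sum G ?u \<theta> = fourier_sum G h \<theta> - fourier_sum G p \<theta>" for \<theta>
      by (simp add: fourier_sum_def fourier_diff hL pL left_diff_distrib sum_subtractf)
    then have "h \<theta> - fourier_sum G h \<theta> = ?u \<theta> - fourier_sum G ?u \<theta>" for \<theta>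
      using elim by (simp add: fun_eq_iff)
    then have "(LINT \<theta>|circle_measure. (cmod (h \<theta> - fourier_sum G h \<theta>))\<^sup>2)
        = (LINT \<theta>|circle_measure. (cmod (?u \<theta>))\<^sup>2) - (\<Sum>x\<in>G. (cmod (fourier ?u x))\<^sup>2)"
      by (simp only: bessel_identity[OF uL conjunct1[OF elim]])
    also have "\<dots> \<le> \<epsilon>\<^sup>2"
      using u_le sum_nonneg[of G "\<lambda>x. (cmod (fourier ?u x))\<^sup>2"] by simp
    also have "\<dots> < e" using \<epsilon> \<open>e > 0\<close> by simp
    finally show ?case by simp
  qed
qed

text \<open>
  A weighted arithmetic-geometric mean form of the Cauchy-Schwarz inequality: choosing \<open>\<eta>\<close> small
  makes the first term small, after which the second is small once \<open>h\<close> is small in \<open>L\<^sup>2\<close>.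
\<close>

lemma norm_L2_inner_le:
  assumes g: "g \<in> L2_circle" and h: "h \<in> L2_circle" and "\<eta> > 0"
  shows "cmod (L2_inner g h) \<le> \<eta> * (LINT \<theta>|circle_measure. (cmod (g \<theta>))\<^sup>2)
           + (LINT \<theta>|circle_measure. (cmod (h \<theta>))\<^sup>2) / \<eta>"
proof -
  have ineq: "a * b \<le> \<eta> * a\<^sup>2 + b\<^sup>2 / \<eta>" if "a \<ge> 0" "b \<ge> 0" for a b :: real
  proof -
    have "2 * (\<eta> * a) * b \<le> (\<eta> * a)\<^sup>2 + b\<^sup>2" by (rule sum_squares_bound)
    moreover have "0 \<le> \<eta> * a * b" using that \<open>\<eta> > 0\<close> by simp
    ultimately have "\<eta> * a * b \<le> (\<eta> * a)\<^sup>2 + b\<^sup>2" by simp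
    then show ?thesis using \<open>\<eta> > 0\<close> by (simp add: field_simps power2_eq_square)
  qed
  have int: "integrable circle_measure (\<lambda>\<theta>. \<eta> * (cmod (g \<theta>))\<^sup>2 + (cmod (h \<theta>))\<^sup>2 / \<eta>)"
    using g h by (auto simp: L2_circle_def)
  have "cmod (L2_inner g h) \<le> (LINT \<theta>|circle_measure. cmod (g \<theta> * cnj (h \<theta>)))"
    unfolding L2_inner_def by (rule integral_norm_bound)
  also have "\<dots> \<le> (LINT \<theta>|circle_measure. \<eta> * (cmod (g \<theta>))\<^sup>2 + (cmod (h \<theta>))\<^sup>2 / \<eta>)"
    by (intro integral_mono integrable_norm integrable_L2_circle_mult g h int) (auto simp: norm_mult ineq)
  also have "\<dots> = \<eta> * (LINT \<theta>|circle_measure. (cmod (g \<theta>))\<^sup>2)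
                    + (LINT \<theta>|circle_measure. (cmod (h \<theta>))\<^sup>2) / \<eta>"
    using g h by (subst Bochner_Integration.integral_add) (auto simp: L2_circle_def)
  finally show ?thesis .
qed

text \<open>
  The difference between \<open>\<langle>g, h\<rangle>\<close> and its partial sum over \<open>G\<close> is the pairing of \<open>g\<close> with the
  remainder of \<open>h\<close>. So \<open>g\<close> may be any square integrable function, as only \<open>h\<close> is approximated.
\<close>

theorem parseval:
  assumes g: "g \<in> L2_circle" and h: "cont_periodic h"
  shows "((\<lambda>x. fourier g x * cnj (fourier h x)) has_sum L2_inner g h) UNIV"
  unfolding has_sum_def
proof (rule tendstoI)
  fix e :: real assume "e > 0"
  define N where "N = (LINT \<theta>|circle_measure. (cmod (g \<theta>))\<^sup>2)"
  have "N \<ge> 0" by (simp add: N_def)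
  \<comment> \<open>Adding 1 covers the case that \<open>g\<close> vanishes almost everywhere.\<close>
  define \<eta> where "\<eta> = e / (2 * (N + 1))"
  have "\<eta> > 0" using \<open>e > 0\<close> \<open>N \<ge> 0\<close> by (simp add: \<eta>_def add_nonneg_pos)
  moreover have "\<eta> * (N + 1) = e / 2"
    using \<open>N \<ge> 0\<close> unfolding \<eta>_def by (simp add: field_simps)
  ultimately have \<eta>: "\<eta> > 0" "\<eta> * N \<le> e / 2" by (auto simp: distrib_left)
  have hL: "h \<in> L2_circle" by (rule cont_periodic_in_L2_circle[OF h])
  have "\<forall>\<^sub>F G in finite_subsets_at_top UNIV.
      (LINT \<theta>|circle_measure. (cmod (h \<theta> - fourier_sum G h \<theta>))\<^sup>2) < \<eta> * (e / 2)"
    by (rule order_tendstoD(2)[OF fourier_sum_tendsto_L2[OF h]]) (use \<eta> \<open>e > 0\<close> in simp)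
  then show "\<forall>\<^sub>F G in finite_subsets_at_top UNIV.
      dist (\<Sum>x\<in>G. fourier g x * cnj (fourier h x)) (L2_inner g h) < e"
  proof eventually_elim
    case (elim G)
    have "dist (\<Sum>x\<in>G. fourier g x * cnj (fourier h x)) (L2_inner g h)
            = cmod (L2_inner g (\<lambda>\<theta>. h \<theta> - fourier_sum G h \<theta>))"
      by (simp add: L2_inner_diff_right g hL fourier_sum_in_L2 L2_inner_fourier_sum_right
          dist_norm norm_minus_commute)
    also have "\<dots> \<le> \<eta> * N + (LINT \<theta>|circle_measure. (cmod (h \<theta> - fourier_sum G h \<theta>))\<^sup>2) / \<eta>"
      unfolding N_def by (intro norm_L2_inner_le g L2_circle_diff hL fourier_sum_in_L2 \<eta>)
    also have "\<dots> < e / 2 + e / 2"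
      using \<eta> elim by (intro add_le_less_mono) (auto simp: field_simps)
    finally show ?case by simp
  qed
qed

section \<open>The walk as multiplication by a phase\<close>

lemma fourier_cong_AE:
  assumes [measurable]: "f \<in> borel_measurable borel" "g \<in> borel_measurable borel"
    and "AE \<theta> in circle_measure. f \<theta> = g \<theta>"
  shows "fourier f = fourier g"
proof
  fix x
  have [measurable]: "expi x \<in> borel_measurable borel"
    by (rule cont_periodic_measurable[OF cont_periodic_expi])
  show "fourier f x = fourier g x"
    unfolding fourier_eq_L2_inner[OF assms(1)] fourier_eq_L2_inner[OF assms(2)] L2_inner_def
    by (rule integral_cong_AE) (use assms(3) in auto)
qed

lemma ell2_inner_fourier:
  assumes "g \<in> L2_circle" "cont_periodic h"
  shows "ell2_inner (fourier g) (fourier h) = L2_inner g h"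
  unfolding ell2_inner_def by (rule infsumI[OF parseval[OF assms]])

text \<open>
  By Parseval's identity \<open>h\<close> has the property that defines the adjoint, so the chosen representative
  \<open>f\<close> satisfies \<open>\<langle>g, f\<rangle> = \<langle>g, h\<rangle>\<close> for all \<open>g\<close>; taking \<open>g = f - h\<close> gives \<open>f = h\<close> almost everywhere.
\<close>

lemma fourier_adj_fourier:
  assumes h: "cont_periodic h"
  shows "fourier_adj (fourier h) \<in> L2_circle"
    and "AE \<theta> in circle_measure. fourier_adj (fourier h) \<theta> = h \<theta>"
proof -
  let ?f = "fourier_adj (fourier h)"
  have hL: "h \<in> L2_circle" by (rule cont_periodic_in_L2_circle[OF h])
  have "?f \<in> L2_circle \<and> (\<forall>g\<in>L2_circle. ell2_inner (fourier g) (fourier h) = L2_inner g ?f)"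
    unfolding fourier_adj_def
    by (rule someI[of _ h]) (use hL ell2_inner_fourier[OF _ h] in auto)
  then have f: "?f \<in> L2_circle" and adj: "\<And>g. g \<in> L2_circle \<Longrightarrow> L2_inner g ?f = L2_inner g h"
    using ell2_inner_fourier[OF _ h] by auto
  show "?f \<in> L2_circle" by (rule f)
  note d = L2_circle_diff[OF f hL]
  have "L2_inner (\<lambda>\<theta>. ?f \<theta> - h \<theta>) (\<lambda>\<theta>. ?f \<theta> - h \<theta>) = 0"
    by (simp add: L2_inner_diff_right[OF d f hL] adj[OF d])
  then have "(LINT \<theta>|circle_measure. (cmod (?f \<theta> - h \<theta>))\<^sup>2) = 0"
    by (simp add: L2_inner_self)
  moreover have "integrable circle_measure (\<lambda>\<theta>. (cmod (?f \<theta> - h \<theta>))\<^sup>2)"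
    using d by (simp add: L2_circle_def)
  ultimately have "AE \<theta> in circle_measure. (cmod (?f \<theta> - h \<theta>))\<^sup>2 = 0"
    by (subst (asm) integral_nonneg_eq_0_iff_AE) auto
  then show "AE \<theta> in circle_measure. ?f \<theta> = h \<theta>" by simp
qed

lemma H_hat_fourier:
  assumes k: "continuous_on UNIV k" and h: "cont_periodic h"
  shows "H_hat k (fourier h) = fourier (\<lambda>\<theta>. of_real (k \<theta>) * h \<theta>)"
proof -
  note [measurable] = borel_measurable_continuous_onI[OF k] cont_periodic_measurable[OF h]
    L2_circle_measurable[OF fourier_adj_fourier(1)[OF h]]
  have "AE \<theta> in circle_measure. mult_op k (fourier_adj (fourier h)) \<theta> = of_real (k \<theta>) * h \<theta>"
    using fourier_adj_fourier(2)[OF h] by eventually_elim (simp add: mult_op_def)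
  then show ?thesis
    unfolding H_hat_def by (intro fourier_cong_AE) (auto simp: mult_op_def [abs_def])
qed

lemma ket_eq_fourier: "ket y = fourier (expi y)"
  by (auto simp: ket_def fourier_expi)

lemma ell2_diff:
  assumes "a \<in> ell2" "b \<in> ell2"
  shows "(\<lambda>x. a x - b x) \<in> ell2"
proof -
  have "(\<lambda>x. 2 * (cmod (a x))\<^sup>2 + 2 * (cmod (b x))\<^sup>2) summable_on UNIV"
    using assms by (intro summable_on_add summable_on_cmult_right) (auto simp: ell2_def)
  then have "(\<lambda>x. (cmod (a x - b x))\<^sup>2) summable_on UNIV"
  proof (rule summable_on_comparison_test)
    fix x
    have "(cmod (a x - b x))\<^sup>2 \<le> (cmod (a x) + cmod (b x))\<^sup>2"
      by (intro power_mono norm_triangle_ineq4) auto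
    also have "\<dots> \<le> 2 * (cmod (a x))\<^sup>2 + 2 * (cmod (b x))\<^sup>2"
      using sum_squares_bound[of "cmod (a x)" "cmod (b x)"] by (simp add: power2_sum)
    finally show "(cmod (a x - b x))\<^sup>2 \<le> 2 * (cmod (a x))\<^sup>2 + 2 * (cmod (b x))\<^sup>2" .
  qed auto
  then show ?thesis by (simp add: ell2_def)
qed

lemma norm_le_ell2_norm:
  assumes "a \<in> ell2"
  shows "cmod (a x) \<le> ell2_norm a"
proof -
  have "(\<Sum>y\<in>{x}. (cmod (a y))\<^sup>2) \<le> (\<Sum>\<^sub>\<infinity>y. (cmod (a y))\<^sup>2)"
    using assms by (intro finite_sum_le_infsum) (auto simp: ell2_def)
  then show ?thesis
    unfolding ell2_norm_def by (intro real_le_rsqrt) simp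
qed

lemma ell2_tendsto_pointwise:
  assumes "\<And>N. p N \<in> ell2" "b \<in> ell2" and lim: "(\<lambda>N. ell2_norm (\<lambda>x. p N x - b x)) \<longlonglongrightarrow> 0"
  shows "(\<lambda>N. p N x) \<longlonglongrightarrow> b x"
proof -
  have "(\<lambda>N. p N x - b x) \<longlonglongrightarrow> 0"
    by (rule Lim_null_comparison[OF _ lim])
       (use norm_le_ell2_norm[OF ell2_diff[OF assms(1,2)]] in auto)
  then show ?thesis by (simp add: LIM_zero_iff)
qed

text \<open>
  Convergence in the norm of \<open>\<ell>\<^sup>2(\<int>)\<close> implies convergence at each site, so the norm limit that defines
  the exponential is unique.
\<close>

lemma op_exp_eqI:
  assumes p: "\<And>N. (\<lambda>x. \<Sum>n<N. (A ^^ n) a x / fact n) \<in> ell2" and b: "b \<in> ell2"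
    and lim: "(\<lambda>N. ell2_norm (\<lambda>x. (\<Sum>n<N. (A ^^ n) a x / fact n) - b x)) \<longlonglongrightarrow> 0"
  shows "op_exp A a = b"
  unfolding op_exp_def
proof (rule the_equality)
  fix b' assume b': "b' \<in> ell2 \<and>
    (\<lambda>N. ell2_norm (\<lambda>x. (\<Sum>n<N. (A ^^ n) a x / fact n) - b' x)) \<longlonglongrightarrow> 0"
  show "b' = b"
  proof
    fix x
    show "b' x = b x"
      using LIMSEQ_unique ell2_tendsto_pointwise[OF p b lim, of x]
        ell2_tendsto_pointwise[OF p conjunct1[OF b'] conjunct2[OF b'], of x] by blast
  qed
qed (use b lim in auto)

lemma plancherel:
  assumes "cont_periodic h"
  shows "((\<lambda>x. (cmod (fourier h x))\<^sup>2) has_sum (LINT \<theta>|circle_measure. (cmod (h \<theta>))\<^sup>2)) UNIV"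
proof -
  have "((\<lambda>x. complex_of_real ((cmod (fourier h x))\<^sup>2))
          has_sum of_real (LINT \<theta>|circle_measure. (cmod (h \<theta>))\<^sup>2)) UNIV"
    using parseval[OF cont_periodic_in_L2_circle[OF assms] assms]
    unfolding L2_inner_self complex_norm_square .
  then show ?thesis by (simp only: has_sum_of_real_iff)
qed

lemma fourier_in_ell2: "cont_periodic h \<Longrightarrow> fourier h \<in> ell2"
  using plancherel[of h] by (auto simp: ell2_def summable_on_def)

lemma ell2_norm_fourier:
  "cont_periodic h \<Longrightarrow> ell2_norm (fourier h) = sqrt (LINT \<theta>|circle_measure. (cmod (h \<theta>))\<^sup>2)"
  unfolding ell2_norm_def by (simp add: infsumI[OF plancherel])

lemma cont_periodic_sum:
  "(\<And>i. i \<in> I \<Longrightarrow> cont_periodic (f i)) \<Longrightarrow> cont_periodic (\<lambda>\<theta>. \<Sum>i\<in>I. f i \<theta>)"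
  by (auto simp: cont_periodic_def intro!: continuous_intros sum.cong)

lemma fourier_fun_sum:
  assumes "finite I" "\<And>i. i \<in> I \<Longrightarrow> cont_periodic (f i)"
  shows "fourier (\<lambda>\<theta>. \<Sum>i\<in>I. f i \<theta>) x = (\<Sum>i\<in>I. fourier (f i) x)"
  using assms
proof (induction I rule: finite_induct)
  case empty
  show ?case by (simp add: fourier_def set_lebesgue_integral_def)
next
  case (insert i I)
  then show ?case
    by (simp add: fourier_add cont_periodic_in_L2_circle cont_periodic_sum)
qed

text \<open>
  Starting from \<open>\<delta>\<^sub>0\<close>, the transform of the constant 1, every partial sum of the operator exponential
  is the transform of the corresponding partial sum of the exponential series of \<open>itk(\<theta>)\<close>. These
  converge at each \<open>\<theta>\<close> and are bounded uniformly because \<open>k\<close> is, hence they converge in \<open>L\<^sup>2\<close>, and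
  the Plancherel identity carries this to \<open>\<ell>\<^sup>2(\<int>)\<close>.
\<close>

lemma op_exp_mult_op:
  fixes k :: "real \<Rightarrow> real"
  assumes k: "continuous_on UNIV k" and per: "\<And>\<theta>. k (\<theta> + 2 * pi) = k \<theta>"
  shows "op_exp (\<lambda>a y. \<i> * of_real t * H_hat k a y) (ket 0) = fourier (\<lambda>\<theta>. cis (t * k \<theta>))"
proof -
  let ?A = "\<lambda>a y. \<i> * of_real t * H_hat k a y"
  define c where "c \<theta> = \<i> * of_real (t * k \<theta>)" for \<theta>
  have c: "continuous_on UNIV c" "\<And>\<theta>. c (\<theta> + 2 * pi) = c \<theta>"
    by (auto simp: c_def per intro!: continuous_intros k)
  have pow: "cont_periodic (\<lambda>\<theta>. c \<theta> ^ n)" for n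
    using c by (auto simp: cont_periodic_def intro!: continuous_intros)
  have exp_term: "cont_periodic (\<lambda>\<theta>. c \<theta> ^ n / fact n)" for n
    using c by (auto simp: cont_periodic_def intro!: continuous_intros)
  have E: "cont_periodic (\<lambda>\<theta>. cis (t * k \<theta>))"
    by (auto simp: cont_periodic_def per intro!: continuous_intros k)
  have iter: "(?A ^^ n) (ket 0) = fourier (\<lambda>\<theta>. c \<theta> ^ n)" for n
  proof (induction n)
    case 0
    show ?case by (simp add: ket_eq_fourier expi_def [abs_def])
  next
    case (Suc n)
    have kc: "cont_periodic (\<lambda>\<theta>. of_real (k \<theta>) * c \<theta> ^ n)"
      using c k per by (auto simp: cont_periodic_def intro!: continuous_intros)
    have "(?A ^^ Suc n) (ket 0) y = fourier (\<lambda>\<theta>. \<i> * of_real t * (of_real (k \<theta>) * c \<theta> ^ n)) y" for y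
      using Suc
      by (simp add: H_hat_fourier[OF k pow] fourier_cmult[OF cont_periodic_in_L2_circle[OF kc]])
    then show ?case by (simp add: fun_eq_iff c_def mult_ac)
  qed
  define S where "S N \<theta> = (\<Sum>n<N. c \<theta> ^ n / fact n)" for N \<theta>
  have S: "cont_periodic (S N)" for N
    unfolding S_def by (intro cont_periodic_sum exp_term)
  have partial: "(\<Sum>n<N. (?A ^^ n) (ket 0) x / fact n) = fourier (S N) x" for N x
  proof -
    have "fourier (\<lambda>\<theta>. c \<theta> ^ n / fact n) x = fourier (\<lambda>\<theta>. c \<theta> ^ n) x / fact n" for n
      using fourier_cmult[OF cont_periodic_in_L2_circle[OF pow], of "1 / fact n" n x] by simp
    then show ?thesis
      unfolding iter S_def by (subst fourier_fun_sum) (auto intro: exp_term)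
  qed
  have diff: "cont_periodic (\<lambda>\<theta>. S N \<theta> - cis (t * k \<theta>))" for N
    using S[of N] E by (auto simp: cont_periodic_def intro!: continuous_intros)
  have "cont_periodic (\<lambda>\<theta>. of_real (k \<theta>))"
    using k per by (auto simp: cont_periodic_def intro!: continuous_intros)
  then obtain B where B: "\<And>\<theta>. \<bar>k \<theta>\<bar> \<le> B"
    using cont_periodic_bounded by (metis norm_of_real)
  have "(\<lambda>N. LINT \<theta>|circle_measure. (cmod (S N \<theta> - cis (t * k \<theta>)))\<^sup>2) \<longlonglongrightarrow> (LINT \<theta>|circle_measure. 0)"
  proof (rule integral_dominated_convergence)
    note [measurable] = cont_periodic_measurable[OF diff]
    show "(\<lambda>\<theta>. (cmod (S N \<theta> - cis (t * k \<theta>)))\<^sup>2) \<in> borel_measurable circle_measure" for N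
      by measurable
    have "S N \<theta> = (\<Sum>n<N. c \<theta> ^ n /\<^sub>R fact n)" for N \<theta>
      by (simp add: S_def scaleR_conv_of_real field_simps)
    moreover have "exp (c \<theta>) = cis (t * k \<theta>)" for \<theta> by (simp add: c_def cis_conv_exp)
    ultimately have lim: "(\<lambda>N. S N \<theta>) \<longlonglongrightarrow> cis (t * k \<theta>)" for \<theta>
      using exp_converges[of "c \<theta>"] by (simp add: sums_def)
    have "(\<lambda>N. (cmod (S N \<theta> - cis (t * k \<theta>)))\<^sup>2) \<longlonglongrightarrow> (cmod (cis (t * k \<theta>) - cis (t * k \<theta>)))\<^sup>2" for \<theta>
      by (intro tendsto_intros lim)
    then show "AE \<theta> in circle_measure. (\<lambda>N. (cmod (S N \<theta> - cis (t * k \<theta>)))\<^sup>2) \<longlonglongrightarrow> 0"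
      by simp
    have "cmod (S N \<theta> - cis (t * k \<theta>)) \<le> exp (\<bar>t\<bar> * B) + 1" for N \<theta>
    proof -
      have "cmod (S N \<theta>) \<le> (\<Sum>n<N. (\<bar>t\<bar> * \<bar>k \<theta>\<bar>) ^ n /\<^sub>R fact n)"
        unfolding S_def
        by (rule order_trans[OF norm_sum])
           (simp add: norm_divide norm_power c_def norm_mult abs_mult field_simps)
      also have "\<dots> \<le> (\<Sum>n. (\<bar>t\<bar> * \<bar>k \<theta>\<bar>) ^ n /\<^sub>R fact n)"
        by (intro sum_le_suminf summable_exp_generic) auto
      also have "\<dots> = exp (\<bar>t\<bar> * \<bar>k \<theta>\<bar>)" by (simp add: exp_def)
      also have "\<dots> \<le> exp (\<bar>t\<bar> * B)" using B by (simp add: mult_left_mono)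
      finally show ?thesis
        using norm_triangle_ineq4[of "S N \<theta>" "cis (t * k \<theta>)"] by simp
    qed
    then show "AE \<theta> in circle_measure. norm ((cmod (S N \<theta> - cis (t * k \<theta>)))\<^sup>2) \<le> (exp (\<bar>t\<bar> * B) + 1)\<^sup>2" for N
      by (auto intro!: AE_I2 power_mono)
  qed auto
  then have "(\<lambda>N. sqrt (LINT \<theta>|circle_measure. (cmod (S N \<theta> - cis (t * k \<theta>)))\<^sup>2)) \<longlonglongrightarrow> sqrt 0"
    by (intro tendsto_real_sqrt) simp
  then have lim: "(\<lambda>N. ell2_norm (fourier (\<lambda>\<theta>. S N \<theta> - cis (t * k \<theta>)))) \<longlonglongrightarrow> 0"
    by (simp add: ell2_norm_fourier[OF diff])
  have "fourier (\<lambda>\<theta>. S N \<theta> - cis (t * k \<theta>)) = (\<lambda>x. fourier (S N) x - fourier (\<lambda>\<theta>. cis (t * k \<theta>)) x)" for N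
    by (simp add: fun_eq_iff fourier_diff cont_periodic_in_L2_circle S E)
  with lim show ?thesis
    by (intro op_exp_eqI) (simp_all add: partial fourier_in_ell2 S E)
qed

lemma ell2_inner_ket: "ell2_inner b (ket x) = b x"
proof -
  have "(\<Sum>\<^sub>\<infinity>y. b y * cnj (ket x y)) = (\<Sum>\<^sub>\<infinity>y\<in>{x}. b y * cnj (ket x y))"
    by (rule infsum_cong_neutral) (auto simp: ket_def)
  then show ?thesis by (simp add: ell2_inner_def ket_def)
qed

theorem walk_prob_eq:
  fixes k :: "real \<Rightarrow> real"
  assumes "continuous_on UNIV k" and "\<And>\<theta>. k (\<theta> + 2 * pi) = k \<theta>"
  shows "walk_prob t k x = (cmod (fourier (\<lambda>\<theta>. cis (t * k \<theta>)) x))\<^sup>2"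
  by (simp only: walk_prob_def op_exp_mult_op[OF assms] ell2_inner_ket)

section \<open>Weak convergence to the law of the group velocity\<close>

lemma fourier_translate:
  assumes h: "cont_periodic h"
  shows "fourier (\<lambda>\<theta>. h (\<theta> + c)) x = expi x c * fourier h x"
proof -
  let ?F = "\<lambda>\<theta>. h \<theta> * cnj (expi x \<theta>)"
  note [measurable] = cont_periodic_measurable[OF h] cont_periodic_measurable[OF cont_periodic_expi]
  have per: "?F (\<theta> + 2 * pi) = ?F \<theta>" for \<theta>
    using h cont_periodic_expi[of x] by (simp add: cont_periodic_def)
  have shift: "cnj (expi x \<theta>) = expi x c * cnj (expi x (\<theta> + c))" for \<theta>
    by (simp add: expi_def cis_cnj cis_mult algebra_simps)
  have "fourier (\<lambda>\<theta>. h (\<theta> + c)) x = L2_inner (\<lambda>\<theta>. h (\<theta> + c)) (expi x)"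
    by (rule fourier_eq_L2_inner) measurable
  also have "\<dots> = (LINT \<theta>|circle_measure. expi x c * ?F (\<theta> + c))"
    unfolding L2_inner_def
    by (rule Bochner_Integration.integral_cong[OF refl], subst shift) (simp only: mult_ac)
  also have "\<dots> = expi x c * (LINT \<theta>|circle_measure. ?F \<theta>)"
    using integral_circle_measure_translate[of ?F c] per by simp
  also have "(LINT \<theta>|circle_measure. ?F \<theta>) = fourier h x"
    by (simp add: fourier_eq_L2_inner L2_inner_def)
  finally show ?thesis .
qed

context
  fixes k :: "real \<Rightarrow> real"
  assumes k: "continuous_on UNIV k" and per: "\<And>\<theta>. k (\<theta> + 2 * pi) = k \<theta>"
begin

lemma cont_periodic_phase: "cont_periodic (\<lambda>\<theta>. cis (t * k (\<theta> + c)))"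
proof (rule cont_periodicI)
  show "continuous_on UNIV (\<lambda>\<theta>. cis (t * k (\<theta> + c)))"
    by (intro continuous_intros continuous_on_compose2[OF k]) auto
  show "cis (t * k (\<theta> + 2 * pi + c)) = cis (t * k (\<theta> + c))" for \<theta>
    using per[of "\<theta> + c"] by (simp add: add_ac)
qed

lemma walk_prob_has_sum: "(walk_prob t k has_sum 1) UNIV"
  using plancherel[OF cont_periodic_phase[of t 0]] circle.prob_space
  by (simp add: walk_prob_eq[OF k per, abs_def])

lemma walk_prob_nonneg: "walk_prob t k x \<ge> 0"
  by (simp add: walk_prob_def)

lemma walk_prob_abs_summable: "Infinite_Set_Sum.abs_summable_on (walk_prob t k) UNIV"
proof -
  have "(\<lambda>x. norm (walk_prob t k x)) summable_on UNIV"
    using walk_prob_has_sum by (auto simp: summable_on_def walk_prob_nonneg)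
  then show ?thesis by (simp only: abs_summable_equivalent)
qed

lemma real_distribution_walk_measure: "real_distribution (walk_measure t k)"
proof -
  have "emeasure (point_measure UNIV (\<lambda>x. ennreal (walk_prob t k x))) UNIV
          = (\<integral>\<^sup>+x. ennreal (walk_prob t k x) \<partial>count_space UNIV)"
    by (simp add: point_measure_def emeasure_density)
  also have "\<dots> = ennreal (infsetsum (walk_prob t k) UNIV)"
    by (rule nn_integral_conv_infsetsum[OF walk_prob_abs_summable walk_prob_nonneg])
  also have "infsetsum (walk_prob t k) UNIV = 1"
    by (simp only: infsetsum_infsum[OF walk_prob_abs_summable] infsumI[OF walk_prob_has_sum])
  finally have "prob_space (point_measure UNIV (\<lambda>x. ennreal (walk_prob t k x)))"
    by (intro prob_spaceI) (simp add: space_point_measure)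
  then have "prob_space (walk_measure t k)"
    unfolding walk_measure_def by (rule prob_space.prob_space_distr) (simp add: point_measure_def)
  then show ?thesis
    by (simp add: real_distribution_def real_distribution_axioms_def walk_measure_def)
qed

text \<open>
  With \<open>u = e\<^bsup>itk\<^esup>\<close>, the factor \<open>e\<^bsup>i\<xi>x/t\<^esup>\<close> times the \<open>x\<close>-th coefficient of \<open>u\<close> is the \<open>x\<close>-th
  coefficient of \<open>u(\<theta> + \<xi>/t)\<close>, so the sum over \<open>x\<close> is the inner product of this translate with \<open>u\<close>.
\<close>

lemma char_walk_measure:
  "char (walk_measure t k) \<xi> = (LINT \<theta>|circle_measure. cis (t * (k (\<theta> + \<xi> / t) - k \<theta>)))"
proof -
  let ?f = "\<lambda>x. complex_of_real (walk_prob t k x) * expi x (\<xi> / t)"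
  have "char (walk_measure t k) \<xi>
          = (LINT x|point_measure UNIV (\<lambda>x. ennreal (walk_prob t k x)). iexp (\<xi> * (of_int x / t)))"
    unfolding char_def walk_measure_def
    by (subst integral_distr) (auto simp: point_measure_def intro!: borel_measurable_continuous_onI continuous_intros)
  also have "\<dots> = infsetsum ?f UNIV"
    unfolding point_measure_def infsetsum_def
    by (subst integral_density)
       (auto simp: walk_prob_nonneg scaleR_conv_of_real expi_def cis_conv_exp mult_ac
          intro!: Bochner_Integration.integral_cong)
  also have "\<dots> = infsum ?f UNIV"
    by (intro infsetsum_infsum abs_summable_on_comparison_test'[OF walk_prob_abs_summable[of t]])
       (simp add: norm_mult expi_def walk_prob_nonneg)
  also have "\<dots> = L2_inner (\<lambda>\<theta>. cis (t * k (\<theta> + \<xi> / t))) (\<lambda>\<theta>. cis (t * k \<theta>))"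
  proof (rule infsumI)
    have h: "cont_periodic (\<lambda>\<theta>. cis (t * k \<theta>))" using cont_periodic_phase[of t 0] by simp
    have "?f x = fourier (\<lambda>\<theta>. cis (t * k (\<theta> + \<xi> / t))) x * cnj (fourier (\<lambda>\<theta>. cis (t * k \<theta>)) x)" for x
      using fourier_translate[OF h, of "\<xi> / t" x]
      by (simp add: walk_prob_eq[OF k per] complex_norm_square mult_ac del: of_real_power)
    then show "(?f has_sum L2_inner (\<lambda>\<theta>. cis (t * k (\<theta> + \<xi> / t))) (\<lambda>\<theta>. cis (t * k \<theta>))) UNIV"
      using parseval[OF cont_periodic_in_L2_circle[OF cont_periodic_phase] h, of t "\<xi> / t"] by simp
  qed
  also have "\<dots> = (LINT \<theta>|circle_measure. cis (t * (k (\<theta> + \<xi> / t) - k \<theta>)))"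
    unfolding L2_inner_def
    by (intro Bochner_Integration.integral_cong) (auto simp: cis_cnj cis_mult algebra_simps)
  finally show ?thesis .
qed

text \<open>
  The phase \<open>t (k(\<theta> + \<xi>/t) - k(\<theta>))\<close> is \<open>\<xi>\<close> times a difference quotient of \<open>k\<close> with step \<open>\<xi>/t\<close>.
  Levy's theorem concerns sequences, so the limit \<open>t \<rightarrow> \<infinity>\<close> is tested along arbitrary sequences.
\<close>

theorem weak_lim_walk_measure:
  assumes deriv: "\<And>\<theta>. (k has_real_derivative k' \<theta>) (at \<theta>)"
    and [measurable]: "k' \<in> borel_measurable borel"
  shows "weak_lim (\<lambda>t. walk_measure t k) (distr circle_measure borel k') at_top"
proof -
  let ?M = "distr circle_measure borel k'"
  have "prob_space ?M" by (rule circle.prob_space_distr) simp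
  then have M: "real_distribution ?M"
    by (simp add: real_distribution_def real_distribution_axioms_def)
  have lim: "(\<lambda>n. LINT x|walk_measure (T n) k. f x) \<longlonglongrightarrow> (LINT x|?M. f x)"
    if T: "filterlim T at_top sequentially" and f: "continuous_on UNIV f" "bounded (range f)"
    for T :: "nat \<Rightarrow> real" and f :: "real \<Rightarrow> real"
  proof -
    have "weak_conv_m (\<lambda>n. walk_measure (T n) k) ?M"
    proof (rule levy_continuity[OF real_distribution_walk_measure M])
      fix \<xi>
      have "(\<lambda>n. LINT \<theta>|circle_measure. cis (T n * (k (\<theta> + \<xi> / T n) - k \<theta>)))
              \<longlonglongrightarrow> (LINT \<theta>|circle_measure. cis (\<xi> * k' \<theta>))"
      proof (rule integral_dominated_convergence[where w = "\<lambda>_. 1"])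
        have [measurable]: "k \<in> borel_measurable borel" by (rule borel_measurable_continuous_onI[OF k])
        have [measurable]: "cis \<in> borel_measurable borel"
          by (intro borel_measurable_continuous_onI continuous_intros)
        show "(\<lambda>\<theta>. cis (T n * (k (\<theta> + \<xi> / T n) - k \<theta>))) \<in> borel_measurable circle_measure" for n
          by measurable
        show "(\<lambda>\<theta>. cis (\<xi> * k' \<theta>)) \<in> borel_measurable circle_measure" by measurable
        have lim: "(\<lambda>n. T n * (k (\<theta> + \<xi> / T n) - k \<theta>)) \<longlonglongrightarrow> \<xi> * k' \<theta>" for \<theta>
        proof (cases "\<xi> = 0")
          case False
          have "(\<lambda>n. \<xi> / T n) \<longlonglongrightarrow> 0"
            by (rule real_tendsto_divide_at_top[OF tendsto_const T])
          moreover have nz: "\<forall>\<^sub>F n in sequentially. T n \<noteq> 0"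
            using filterlim_at_top_dense[THEN iffD1, OF T, rule_format, of 0]
            by (auto elim: eventually_mono)
          ultimately have "filterlim (\<lambda>n. \<xi> / T n) (at 0) sequentially"
            using False by (intro filterlim_atI) (auto elim: eventually_mono)
          then have "(\<lambda>n. (k (\<theta> + \<xi> / T n) - k \<theta>) / (\<xi> / T n)) \<longlonglongrightarrow> k' \<theta>"
            using deriv[of \<theta>] unfolding DERIV_def by (rule filterlim_compose[rotated])
          then have "(\<lambda>n. \<xi> * ((k (\<theta> + \<xi> / T n) - k \<theta>) / (\<xi> / T n))) \<longlonglongrightarrow> \<xi> * k' \<theta>"
            by (intro tendsto_intros)
          then show ?thesis
            by (rule Lim_transform_eventually) (use nz False in \<open>auto elim!: eventually_mono\<close>)
        qed simp
        have "isCont cis x" for x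
          using continuous_on_cis[OF continuous_on_id, of UNIV]
          by (simp add: continuous_on_eq_continuous_at)
        from isCont_tendsto_compose[OF this lim] show "AE \<theta> in circle_measure.
            (\<lambda>n. cis (T n * (k (\<theta> + \<xi> / T n) - k \<theta>))) \<longlonglongrightarrow> cis (\<xi> * k' \<theta>)"
          by (intro AE_I2)
      qed auto
      also have "(LINT \<theta>|circle_measure. cis (\<xi> * k' \<theta>)) = char ?M \<xi>"
        unfolding char_def
        by (subst integral_distr)
           (auto simp: cis_conv_exp intro!: borel_measurable_continuous_onI continuous_intros)
      finally show "(\<lambda>n. char (walk_measure (T n) k) \<xi>) \<longlonglongrightarrow> char ?M \<xi>"
        by (simp only: char_walk_measure)
    qed
    moreover obtain B where "\<And>x. norm (f x) \<le> B" using f(2) by (auto simp: bounded_iff)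
    ultimately show ?thesis
      using f(1) M real_distribution_walk_measure
      by (intro weak_conv_imp_integral_bdd_continuous_conv[where B = B])
         (auto simp: continuous_on_eq_continuous_at)
  qed
  show ?thesis
    unfolding weak_lim_def
    by (intro conjI allI impI M always_eventually real_distribution_walk_measure)
       (rule tendsto_at_topI_sequentially, rule lim, auto)
qed

end

section \<open>Laws of the group velocities\<close>

text \<open>
  The derivative of \<open>arccos (s cos \<theta>)\<close>, and minus that of \<open>arcsin (s cos \<theta>)\<close>.
\<close>

definition speed :: "real \<Rightarrow> real \<Rightarrow> real" where
  "speed s \<theta> = s * sin \<theta> / sqrt (1 - (s * cos \<theta>)\<^sup>2)"

context
  fixes s :: real
  assumes s: "0 < s" "s < 1"
begin

lemma abs_s_cos_less: "\<bar>s * cos \<theta>\<bar> < 1"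
proof -
  have "\<bar>s * cos \<theta>\<bar> \<le> s * 1"
    unfolding abs_mult using s by (intro mult_mono) auto
  then show ?thesis using s by linarith
qed

lemma radicand_pos: "0 < 1 - (s * cos \<theta>)\<^sup>2"
  using abs_s_cos_less[of \<theta>] by (simp add: abs_square_less_1)

text \<open>
  A rotation by \<open>\<pi>\<close> preserves the uniform measure, so this absorbs the sign in the derivative of
  \<open>arcsin (s cos \<theta>)\<close>.
\<close>

lemma speed_antiperiodic: "speed s (\<theta> + pi) = - speed s \<theta>"
  by (simp add: speed_def)

lemma has_real_derivative_arccos_s_cos:
  "((\<lambda>\<theta>. arccos (s * cos \<theta>)) has_real_derivative speed s \<theta>) (at \<theta>)"
  using abs_s_cos_less[of \<theta>]
  by (auto intro!: derivative_eq_intros simp: speed_def field_simps)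

lemma has_real_derivative_arcsin_s_cos:
  "((\<lambda>\<theta>. arcsin (s * cos \<theta>)) has_real_derivative - speed s \<theta>) (at \<theta>)"
  using abs_s_cos_less[of \<theta>]
  by (auto intro!: derivative_eq_intros simp: speed_def field_simps)

lemma has_real_derivative_speed:
  "(speed s has_real_derivative
      s * cos \<theta> * (1 - s\<^sup>2) / ((1 - (s * cos \<theta>)\<^sup>2) * sqrt (1 - (s * cos \<theta>)\<^sup>2))) (at \<theta>)"
proof -
  define w where "w = 1 - (s * cos \<theta>)\<^sup>2"
  have w: "w > 0" unfolding w_def by (rule radicand_pos)
  have w_sin: "w = 1 - s\<^sup>2 + s\<^sup>2 * (sin \<theta>)\<^sup>2"
    by (simp add: w_def power_mult_distrib cos_squared_eq algebra_simps)
  have "(speed s has_real_derivative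
      (s * cos \<theta> * sqrt w - s * sin \<theta> * (s * cos \<theta> * (s * sin \<theta>) / sqrt w)) / (sqrt w * sqrt w)) (at \<theta>)"
    unfolding speed_def [abs_def] w_def using radicand_pos[of \<theta>]
    by (auto intro!: derivative_eq_intros simp: field_simps power2_eq_square)
  also have "(s * cos \<theta> * sqrt w - s * sin \<theta> * (s * cos \<theta> * (s * sin \<theta>) / sqrt w)) / (sqrt w * sqrt w)
       = s * cos \<theta> * (w - s\<^sup>2 * (sin \<theta>)\<^sup>2) / (w * sqrt w)"
    using w by (simp add: field_simps power2_eq_square)
  also have "w - s\<^sup>2 * (sin \<theta>)\<^sup>2 = 1 - s\<^sup>2" by (simp add: w_sin)
  finally show ?thesis by (simp add: w_def)
qed

lemma continuous_speed: "continuous_on UNIV (speed s)"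
  using has_real_derivative_speed by (meson DERIV_isCont continuous_at_imp_continuous_on)

text \<open>
  Write \<open>w = 1 - s\<^sup>2 cos\<^sup>2 \<theta>\<close>, \<open>r\<^sup>2 = 1 - s\<^sup>2\<close>, and \<open>v\<close> for the speed at \<open>\<theta>\<close>. Then \<open>1 - v\<^sup>2 = r\<^sup>2/w\<close> and
  \<open>s\<^sup>2 - v\<^sup>2 = s\<^sup>2 r\<^sup>2 cos\<^sup>2 \<theta> / w\<close>, while the derivative of \<open>v\<close> is \<open>s r\<^sup>2 cos \<theta> / w\<^bsup>3/2\<^esup>\<close>; in the product
  with the density everything but \<open>1/\<pi>\<close> cancels. The scale \<open>\<beta>\<close> is 1 for \<open>\<phi>\<^sub>s\<close> and \<open>arcsin s\<close> for
  \<open>\<psi>\<^sub>s\<close>.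
\<close>

lemma distr_speed:
  assumes \<beta>: "\<beta> > 0"
  shows "distr circle_measure borel (\<lambda>\<theta>. speed s \<theta> / \<beta>) =
     density lborel (\<lambda>x. ennreal (\<beta> * sqrt (1 - s\<^sup>2) /
        (pi * (1 - \<beta>\<^sup>2 * x\<^sup>2) * sqrt (s\<^sup>2 - \<beta>\<^sup>2 * x\<^sup>2)) * indicator {-(s / \<beta>)<..<s / \<beta>} x))"
proof (rule distr_circle_measure_eq_density[where a = "- pi / 2"])
  let ?w = "\<lambda>\<theta>. 1 - (s * cos \<theta>)\<^sup>2"
  let ?g' = "\<lambda>\<theta>. s * cos \<theta> * (1 - s\<^sup>2) / (?w \<theta> * sqrt (?w \<theta>)) / \<beta>"
  have s2: "s\<^sup>2 < 1" using s by (simp add: power_less_one_iff)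
  show "speed s (\<theta> + 2 * pi) / \<beta> = speed s \<theta> / \<beta>" for \<theta> by (simp add: speed_def)
  have "sin (- pi - \<theta>) = sin \<theta>" "cos (- pi - \<theta>) = - cos \<theta>" for \<theta> :: real
    by (simp_all add: sin_diff cos_diff)
  then show "speed s (2 * (- pi / 2) - \<theta>) / \<beta> = speed s \<theta> / \<beta>" for \<theta> by (simp add: speed_def)
  show "((\<lambda>\<theta>. speed s \<theta> / \<beta>) has_real_derivative ?g' \<theta>) (at \<theta>)" for \<theta>
    by (intro DERIV_cdivide has_real_derivative_speed)
  show "continuous_on UNIV ?g'"
    using radicand_pos \<beta> by (intro continuous_intros) (auto simp: less_imp_neq[symmetric])
  show "0 \<le> ?g' \<theta>" if "\<theta> \<in> {- pi / 2..- pi / 2 + pi}" for \<theta>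
    using that s s2 \<beta> radicand_pos[of \<theta>]
    by (intro divide_nonneg_nonneg mult_nonneg_nonneg cos_ge_zero) auto
  show "(\<lambda>x. \<beta> * sqrt (1 - s\<^sup>2) / (pi * (1 - \<beta>\<^sup>2 * x\<^sup>2) * sqrt (s\<^sup>2 - \<beta>\<^sup>2 * x\<^sup>2))
          * indicator {-(s / \<beta>)<..<s / \<beta>} x) \<in> borel_measurable borel"
    by measurable
  fix x assume "x \<notin> {speed s (- pi / 2) / \<beta>..speed s (- pi / 2 + pi) / \<beta>}"
  then show "\<beta> * sqrt (1 - s\<^sup>2) / (pi * (1 - \<beta>\<^sup>2 * x\<^sup>2) * sqrt (s\<^sup>2 - \<beta>\<^sup>2 * x\<^sup>2))
          * indicator {-(s / \<beta>)<..<s / \<beta>} x = 0"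
    by (auto simp: speed_def indicator_def)
next
  fix \<theta> assume "\<theta> \<in> {- pi / 2<..<- pi / 2 + pi}"
  then have cos: "cos \<theta> > 0" by (intro cos_gt_zero_pi) auto
  define w where "w = 1 - (s * cos \<theta>)\<^sup>2"
  define r where "r = sqrt (1 - s\<^sup>2)"
  have s2: "s\<^sup>2 < 1" using s by (simp add: power_less_one_iff)
  have r: "r > 0" "r\<^sup>2 = 1 - s\<^sup>2" using s2 by (auto simp: r_def)
  have w: "w > 0" unfolding w_def by (rule radicand_pos)
  have w_sin: "w = r\<^sup>2 + s\<^sup>2 * (sin \<theta>)\<^sup>2"
    by (simp add: w_def r power_mult_distrib cos_squared_eq algebra_simps)
  have x2: "(speed s \<theta>)\<^sup>2 = s\<^sup>2 * (sin \<theta>)\<^sup>2 / w"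
    using w by (simp add: speed_def w_def power_divide power_mult_distrib)
  have one: "1 - (speed s \<theta>)\<^sup>2 = r\<^sup>2 / w"
    using w by (simp add: x2 field_simps) (simp add: w_sin)
  have "w - (sin \<theta>)\<^sup>2 = (cos \<theta> * r)\<^sup>2"
    by (simp add: w_def r power_mult_distrib cos_squared_eq algebra_simps)
  then have "s\<^sup>2 - (speed s \<theta>)\<^sup>2 = (s * cos \<theta> * r)\<^sup>2 / w"
    using w unfolding x2 by (simp add: field_simps power_mult_distrib)
  then have two: "s\<^sup>2 - (speed s \<theta>)\<^sup>2 = (s * cos \<theta> * r / sqrt w)\<^sup>2"
    using w by (simp add: power_divide)
  have pos: "s * cos \<theta> * r / sqrt w > 0" using s cos r w by simp
  have "(speed s \<theta>)\<^sup>2 < s\<^sup>2" using two pos by (smt (verit) zero_less_power)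
  then have "\<bar>speed s \<theta>\<bar> < s" using s power2_less_imp_less[of "\<bar>speed s \<theta>\<bar>" s] by simp
  then have ind: "indicator {-(s / \<beta>)<..<s / \<beta>} (speed s \<theta> / \<beta>) = (1 :: real)"
    using \<beta> by (auto simp: field_simps abs_less_iff)
  have scale: "\<beta>\<^sup>2 * (speed s \<theta> / \<beta>)\<^sup>2 = (speed s \<theta>)\<^sup>2" using \<beta> by (simp add: power_divide)
  have "\<beta> * r / (pi * (r\<^sup>2 / w) * (s * cos \<theta> * r / sqrt w))
          * (s * cos \<theta> * r\<^sup>2 / (w * sqrt w) / \<beta>) = 1 / pi"
    using \<beta> r(1) w s cos by (simp add: field_simps power2_eq_square)
  then show "\<beta> * sqrt (1 - s\<^sup>2) / (pi * (1 - \<beta>\<^sup>2 * (speed s \<theta> / \<beta>)\<^sup>2) * sqrt (s\<^sup>2 - \<beta>\<^sup>2 * (speed s \<theta> / \<beta>)\<^sup>2))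
          * indicator {-(s / \<beta>)<..<s / \<beta>} (speed s \<theta> / \<beta>)
          * (s * cos \<theta> * (1 - s\<^sup>2) / ((1 - (s * cos \<theta>)\<^sup>2) * sqrt (1 - (s * cos \<theta>)\<^sup>2)) / \<beta>) = 1 / pi"
    unfolding scale one two real_sqrt_abs abs_of_pos[OF pos] abs_of_pos[OF r(1)] ind mult_1_right
      r_def[symmetric] r(2)[symmetric] w_def[symmetric] .
qed

theorem weak_lim_\<phi>:
  "weak_lim (\<lambda>t. walk_measure t (\<phi> s))
     (density lborel (\<lambda>x. ennreal (sqrt (1 - s\<^sup>2) / (pi * (1 - x\<^sup>2) * sqrt (s\<^sup>2 - x\<^sup>2))
        * indicator {-s<..<s} x))) at_top"
proof -
  have deriv: "(\<phi> s has_real_derivative speed s \<theta>) (at \<theta>)" for \<theta>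
    unfolding \<phi>_def [abs_def] by (rule has_real_derivative_arccos_s_cos)
  have "continuous_on UNIV (\<phi> s)"
    using deriv by (meson DERIV_isCont continuous_at_imp_continuous_on)
  then have "weak_lim (\<lambda>t. walk_measure t (\<phi> s)) (distr circle_measure borel (speed s)) at_top"
    by (rule weak_lim_walk_measure[OF _ _ deriv])
       (auto simp: \<phi>_def intro: borel_measurable_continuous_onI continuous_speed)
  then show ?thesis
    using distr_speed[of 1] by simp
qed

theorem weak_lim_\<psi>:
  "weak_lim (\<lambda>t. walk_measure t (\<psi> s))
     (density lborel (\<lambda>x. ennreal (arcsin s * sqrt (1 - s\<^sup>2) /
        (pi * (1 - (arcsin s)\<^sup>2 * x\<^sup>2) * sqrt (s\<^sup>2 - (arcsin s)\<^sup>2 * x\<^sup>2))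
        * indicator {-(s / arcsin s)<..<s / arcsin s} x))) at_top"
proof -
  have \<rho>: "arcsin s > 0" using s arcsin_less_arcsin[of 0 s] by simp
  have deriv: "(\<psi> s has_real_derivative speed s (\<theta> + pi) / arcsin s) (at \<theta>)" for \<theta>
    using DERIV_cmult[OF has_real_derivative_arcsin_s_cos[of \<theta>], of "1 / arcsin s"]
    by (simp add: \<psi>_def [abs_def] speed_antiperiodic)
  have [measurable]: "speed s \<in> borel_measurable borel"
    by (rule borel_measurable_continuous_onI[OF continuous_speed])
  have "continuous_on UNIV (\<psi> s)"
    using deriv by (meson DERIV_isCont continuous_at_imp_continuous_on)
  then have "weak_lim (\<lambda>t. walk_measure t (\<psi> s))
      (distr circle_measure borel (\<lambda>\<theta>. speed s (\<theta> + pi) / arcsin s)) at_top"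
    by (rule weak_lim_walk_measure[OF _ _ deriv]) (auto simp: \<psi>_def)
  also have "distr circle_measure borel (\<lambda>\<theta>. speed s (\<theta> + pi) / arcsin s)
      = distr circle_measure borel (\<lambda>\<theta>. speed s \<theta> / arcsin s)"
    by (rule distr_circle_measure_translate[of "\<lambda>\<theta>. speed s \<theta> / arcsin s"]) (auto simp: speed_def)
  finally show ?thesis by (simp only: distr_speed[OF \<rho>])
qed

end

lemma distr_sin:
  "distr circle_measure borel sin
     = density lborel (\<lambda>x. ennreal (1 / (pi * sqrt (1 - x\<^sup>2)) * indicator {-1<..<1} x))"
proof (rule distr_circle_measure_eq_density[where a = "- pi / 2" and g' = cos])
  show "sin (2 * (- pi / 2) - \<theta>) = sin \<theta>" for \<theta> :: real by (simp add: sin_diff)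
  show "0 \<le> cos \<theta>" if "\<theta> \<in> {- pi / 2..- pi / 2 + pi}" for \<theta> :: real
    using that by (intro cos_ge_zero) auto
  show "1 / (pi * sqrt (1 - (sin \<theta>)\<^sup>2)) * indicator {-1<..<1} (sin \<theta>) * cos \<theta> = 1 / pi"
    if "\<theta> \<in> {- pi / 2<..<- pi / 2 + pi}" for \<theta>
  proof -
    have cos: "cos \<theta> > 0" using that by (intro cos_gt_zero_pi) auto
    then have "(sin \<theta>)\<^sup>2 < 1" by (simp add: sin_squared_eq)
    then have "sin \<theta> \<in> {-1<..<1}" by (auto simp: abs_square_less_1)
    then show ?thesis using cos by (simp add: cos_squared_eq[symmetric])
  qed
qed (auto intro!: derivative_eq_intros continuous_intros simp: indicator_def)

theorem weak_lim_\<psi>\<^sub>0: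
  "weak_lim (\<lambda>t. walk_measure t \<psi>\<^sub>0)
     (density lborel (\<lambda>x. ennreal (1 / (pi * sqrt (1 - x\<^sup>2)) * indicator {-1<..<1} x))) at_top"
proof -
  have "weak_lim (\<lambda>t. walk_measure t \<psi>\<^sub>0) (distr circle_measure borel (\<lambda>\<theta>. sin (\<theta> + pi))) at_top"
    by (rule weak_lim_walk_measure)
       (auto simp: \<psi>\<^sub>0_def [abs_def] intro!: derivative_eq_intros continuous_intros)
  also have "distr circle_measure borel (\<lambda>\<theta>. sin (\<theta> + pi)) = distr circle_measure borel (sin :: real \<Rightarrow> real)"
    by (rule distr_circle_measure_translate) auto
  finally show ?thesis by (simp only: distr_sin)
qed

theorem theorem2:
  shows "weak_lim (\<lambda>t. walk_measure t \<psi>\<^sub>0)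
           (density lborel (\<lambda>x. ennreal (1 / (pi * sqrt (1 - x\<^sup>2)) * indicator {-1<..<1} x))) at_top
       \<and> (\<forall>s. 0 < s \<and> s < 1 \<longrightarrow>
           (let r = sqrt (1 - s\<^sup>2) in
            weak_lim (\<lambda>t. walk_measure t (\<phi> s))
              (density lborel (\<lambda>x. ennreal
                 (r / (pi * (1 - x\<^sup>2) * sqrt (s\<^sup>2 - x\<^sup>2)) * indicator {-s<..<s} x))) at_top))
       \<and> (\<forall>s. 0 < s \<and> s < 1 \<longrightarrow>
           (let r = sqrt (1 - s\<^sup>2); \<rho> = arcsin s in
            weak_lim (\<lambda>t. walk_measure t (\<psi> s))
              (density lborel (\<lambda>x. ennreal
                 (\<rho> * r / (pi * (1 - \<rho>\<^sup>2 * x\<^sup>2) * sqrt (s\<^sup>2 - \<rho>\<^sup>2 * x\<^sup>2))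
                    * indicator {-(s / \<rho>)<..<s / \<rho>} x))) at_top))"
  unfolding Let_def using weak_lim_\<psi>\<^sub>0 weak_lim_\<phi> weak_lim_\<psi> by blast

end
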